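(* Let $\Bbbk$ be a field, let $H$ be a cocommutative Hopf algebra over $\Bbbk$, let $M,Q$ be left $H$-module coalgebras, and let $q\colon M\twoheadrightarrow Q$ be a surjective $H$-linear counital coalgebra morphism. If $M$ is amenable, then $Q$ is amenable.
   Context: A left $H$-module coalgebra is a coalgebra $M$ endowed with a left $H$-module structure such that the action map $H\otimes M\to M$ is a (counital) coalgebra map, i.e. $\Delta(hm)=\sum h_{(1)}m_{(1)}\otimes h_{(2)}m_{(2)}$ and $\varepsilon(hm)=\varepsilon(h)\varepsilon(m)$. For subspaces $F\le H$ and $E\le M$, $FE$ denotes the linear span of $\{fe: f\in F, e\in E\}$. $M$ is called amenable if for every finite-dimensional subspace $F\le H$ and every $\epsilon>0$ there exists a finite-dimensional subcoalgebra $E\le M$ with $\dim\frac{E+FE}{E}<\epsilon\dim E$ (the strict inequality forces $E\ne0$). *)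

theory Defs
  imports Complex_Main
begin

section \<open>Tensor powers of a vector space\<close>

text \<open>
  The list \<open>[(a\<^sub>1, b\<^sub>1), \<dots>, (a\<^sub>n, b\<^sub>n)]\<close> stands for the formal sum
  \<open>a\<^sub>1 \<otimes> b\<^sub>1 + \<dots> + a\<^sub>n \<otimes> b\<^sub>n\<close>.  The tensor square of a vector space with scalar
  multiplication \<open>s\<close> is the quotient of all such formal sums by the congruence
  \<open>tensor2_eq s\<close>; the vector space structure on the quotient is concatenation together
  with \<open>c \<cdot> (a \<otimes> b) = s c a \<otimes> b\<close>.  Negatives are given by \<open>- (a \<otimes> b) = (- a) \<otimes> b\<close>, which
  requires the relation \<open>0 \<otimes> b = 0\<close> (with \<open>0\<close> the empty sum) among the generating ones:
  it does not follow from the other relations for formal sums without negatives.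
\<close>

inductive formal_sum_eq :: "('x list \<Rightarrow> 'x list \<Rightarrow> bool) \<Rightarrow> 'x list \<Rightarrow> 'x list \<Rightarrow> bool"
  for R :: "'x list \<Rightarrow> 'x list \<Rightarrow> bool"
  where
    gen: "R xs ys \<Longrightarrow> formal_sum_eq R xs ys"
  | comm: "formal_sum_eq R (xs @ ys) (ys @ xs)"
  | append: "\<lbrakk>formal_sum_eq R xs xs'; formal_sum_eq R ys ys'\<rbrakk>
      \<Longrightarrow> formal_sum_eq R (xs @ ys) (xs' @ ys')"
  | refl: "formal_sum_eq R xs xs"
  | sym: "formal_sum_eq R xs ys \<Longrightarrow> formal_sum_eq R ys xs"
  | trans: "\<lbrakk>formal_sum_eq R xs ys; formal_sum_eq R ys zs\<rbrakk> \<Longrightarrow> formal_sum_eq R xs zs"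

inductive tensor2_gen ::
  "('k \<Rightarrow> 'a \<Rightarrow> 'a) \<Rightarrow> ('a::ab_group_add \<times> 'a) list \<Rightarrow> ('a \<times> 'a) list \<Rightarrow> bool"
  for s :: "'k \<Rightarrow> 'a \<Rightarrow> 'a"
  where
    "tensor2_gen s [(0, b)] []"
  | "tensor2_gen s [(a + a', b)] [(a, b), (a', b)]"
  | "tensor2_gen s [(a, b + b')] [(a, b), (a, b')]"
  | "tensor2_gen s [(s c a, b)] [(a, s c b)]"

abbreviation tensor2_eq ::
  "('k \<Rightarrow> 'a \<Rightarrow> 'a) \<Rightarrow> ('a::ab_group_add \<times> 'a) list \<Rightarrow> ('a \<times> 'a) list \<Rightarrow> bool"
  where "tensor2_eq s \<equiv> formal_sum_eq (tensor2_gen s)"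

inductive tensor3_gen ::
  "('k \<Rightarrow> 'a \<Rightarrow> 'a) \<Rightarrow> ('a::ab_group_add \<times> 'a \<times> 'a) list \<Rightarrow> ('a \<times> 'a \<times> 'a) list \<Rightarrow> bool"
  for s :: "'k \<Rightarrow> 'a \<Rightarrow> 'a"
  where
    "tensor3_gen s [(0, b, d)] []"
  | "tensor3_gen s [(a + a', b, d)] [(a, b, d), (a', b, d)]"
  | "tensor3_gen s [(a, b + b', d)] [(a, b, d), (a, b', d)]"
  | "tensor3_gen s [(a, b, d + d')] [(a, b, d), (a, b, d')]"
  | "tensor3_gen s [(s c a, b, d)] [(a, s c b, d)]"
  | "tensor3_gen s [(a, s c b, d)] [(a, b, s c d)]"

abbreviation tensor3_eq ::
  "('k \<Rightarrow> 'a \<Rightarrow> 'a) \<Rightarrow> ('a::ab_group_add \<times> 'a \<times> 'a) list \<Rightarrow> ('a \<times> 'a \<times> 'a) list \<Rightarrow> bool"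
  where "tensor3_eq s \<equiv> formal_sum_eq (tensor3_gen s)"


section \<open>Coalgebras and Hopf algebras\<close>

text \<open>
  As in Sweedler's notation, \<open>\<Delta> x\<close> is a formal sum representing the coproduct of \<open>x\<close>.
  The choice of the representative is immaterial, since \<open>\<Delta>\<close> is only ever used up to
  equality of tensors or inside expressions that are bilinear in the tensor factors.
\<close>

locale coalgebra = vector_space scale
  for scale :: "'k::field \<Rightarrow> 'a::ab_group_add \<Rightarrow> 'a" +
  fixes \<Delta> :: "'a \<Rightarrow> ('a \<times> 'a) list"
    and \<epsilon> :: "'a \<Rightarrow> 'k"
  assumes comult_add: "tensor2_eq scale (\<Delta> (x + y)) (\<Delta> x @ \<Delta> y)"
    and comult_scale: "tensor2_eq scale (\<Delta> (scale c x)) [(scale c a, b). (a, b) \<leftarrow> \<Delta> x]"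
    and counit_linear: "Vector_Spaces.linear scale (*) \<epsilon>"
    and coassoc: "tensor3_eq scale
          [(a\<^sub>1, a\<^sub>2, b). (a, b) \<leftarrow> \<Delta> x, (a\<^sub>1, a\<^sub>2) \<leftarrow> \<Delta> a]
          [(a, b\<^sub>1, b\<^sub>2). (a, b) \<leftarrow> \<Delta> x, (b\<^sub>1, b\<^sub>2) \<leftarrow> \<Delta> b]"
    and counit_left: "(\<Sum>(a, b) \<leftarrow> \<Delta> x. scale (\<epsilon> a) b) = x"
    and counit_right: "(\<Sum>(a, b) \<leftarrow> \<Delta> x. scale (\<epsilon> b) a) = x"

text \<open>
  The class \<open>ring_1\<close> demands \<open>0 \<noteq> 1\<close>, which is no restriction for a bialgebra over a
  field because of \<open>\<epsilon> 1 = 1\<close>.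
\<close>

locale bialgebra = coalgebra scale \<Delta> \<epsilon>
  for scale :: "'k::field \<Rightarrow> 'h::ring_1 \<Rightarrow> 'h"
    and \<Delta> :: "'h \<Rightarrow> ('h \<times> 'h) list"
    and \<epsilon> :: "'h \<Rightarrow> 'k" +
  assumes scale_mult_left: "scale c x * y = scale c (x * y)"
    and scale_mult_right: "x * scale c y = scale c (x * y)"
    and comult_mult: "tensor2_eq scale (\<Delta> (x * y))
          [(a * a', b * b'). (a, b) \<leftarrow> \<Delta> x, (a', b') \<leftarrow> \<Delta> y]"
    and comult_one: "tensor2_eq scale (\<Delta> 1) [(1, 1)]"
    and counit_mult: "\<epsilon> (x * y) = \<epsilon> x * \<epsilon> y"
    and counit_one: "\<epsilon> 1 = 1"

locale hopf_algebra = bialgebra scale \<Delta> \<epsilon>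
  for scale :: "'k::field \<Rightarrow> 'h::ring_1 \<Rightarrow> 'h"
    and \<Delta> :: "'h \<Rightarrow> ('h \<times> 'h) list"
    and \<epsilon> :: "'h \<Rightarrow> 'k" +
  fixes S :: "'h \<Rightarrow> 'h"
  assumes antipode_linear: "Vector_Spaces.linear scale scale S"
    and antipode_left: "(\<Sum>(a, b) \<leftarrow> \<Delta> x. S a * b) = scale (\<epsilon> x) 1"
    and antipode_right: "(\<Sum>(a, b) \<leftarrow> \<Delta> x. a * S b) = scale (\<epsilon> x) 1"

definition cocommutative ::
  "('k::field \<Rightarrow> 'a::ab_group_add \<Rightarrow> 'a) \<Rightarrow> ('a \<Rightarrow> ('a \<times> 'a) list) \<Rightarrow> bool"
  where "cocommutative s \<Delta> \<longleftrightarrow> (\<forall>x. tensor2_eq s (\<Delta> x) [(b, a). (a, b) \<leftarrow> \<Delta> x])"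


section \<open>Module coalgebras\<close>

locale module_coalgebra =
  H: bialgebra scaleH \<Delta>H \<epsilon>H + M: coalgebra scaleM \<Delta>M \<epsilon>M
  for scaleH :: "'k::field \<Rightarrow> 'h::ring_1 \<Rightarrow> 'h"
    and \<Delta>H :: "'h \<Rightarrow> ('h \<times> 'h) list"
    and \<epsilon>H :: "'h \<Rightarrow> 'k"
    and scaleM :: "'k \<Rightarrow> 'm::ab_group_add \<Rightarrow> 'm"
    and \<Delta>M :: "'m \<Rightarrow> ('m \<times> 'm) list"
    and \<epsilon>M :: "'m \<Rightarrow> 'k" +
  fixes act :: "'h \<Rightarrow> 'm \<Rightarrow> 'm"
  assumes act_add_left: "act (h + h') m = act h m + act h' m"
    and act_add_right: "act h (m + m') = act h m + act h m'"
    and act_scale_left: "act (scaleH c h) m = scaleM c (act h m)"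
    and act_scale_right: "act h (scaleM c m) = scaleM c (act h m)"
    and act_one: "act 1 m = m"
    and act_mult: "act (h * h') m = act h (act h' m)"
    and comult_act: "tensor2_eq scaleM (\<Delta>M (act h m))
          [(act h\<^sub>1 m\<^sub>1, act h\<^sub>2 m\<^sub>2). (h\<^sub>1, h\<^sub>2) \<leftarrow> \<Delta>H h, (m\<^sub>1, m\<^sub>2) \<leftarrow> \<Delta>M m]"
    and counit_act: "\<epsilon>M (act h m) = \<epsilon>H h * \<epsilon>M m"

definition coalgebra_morphism ::
  "('k::field \<Rightarrow> 'm::ab_group_add \<Rightarrow> 'm) \<Rightarrow> ('m \<Rightarrow> ('m \<times> 'm) list) \<Rightarrow> ('m \<Rightarrow> 'k) \<Rightarrow>
   ('k \<Rightarrow> 'q::ab_group_add \<Rightarrow> 'q) \<Rightarrow> ('q \<Rightarrow> ('q \<times> 'q) list) \<Rightarrow> ('q \<Rightarrow> 'k) \<Rightarrow>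
   ('m \<Rightarrow> 'q) \<Rightarrow> bool"
  where
    "coalgebra_morphism sM \<Delta>M \<epsilon>M sQ \<Delta>Q \<epsilon>Q q \<longleftrightarrow>
       Vector_Spaces.linear sM sQ q \<and>
       (\<forall>m. tensor2_eq sQ (\<Delta>Q (q m)) [(q a, q b). (a, b) \<leftarrow> \<Delta>M m]) \<and>
       (\<forall>m. \<epsilon>Q (q m) = \<epsilon>M m)"


section \<open>Finite-dimensional subspaces, subcoalgebras and quotients\<close>

definition fin_dim_subspace ::
  "('k::field \<Rightarrow> 'a::ab_group_add \<Rightarrow> 'a) \<Rightarrow> 'a set \<Rightarrow> bool"
  where "fin_dim_subspace s F \<longleftrightarrow> module.subspace s F \<and> (\<exists>B. finite B \<and> module.span s B = F)"

text \<open>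
  A tensor lies in the image of \<open>E \<otimes> E\<close> if some formal sum representing it has all its
  terms in \<open>E \<times> E\<close>.
\<close>

definition subcoalgebra ::
  "('k::field \<Rightarrow> 'a::ab_group_add \<Rightarrow> 'a) \<Rightarrow> ('a \<Rightarrow> ('a \<times> 'a) list) \<Rightarrow> 'a set \<Rightarrow> bool"
  where "subcoalgebra s \<Delta> E \<longleftrightarrow>
    module.subspace s E \<and> (\<forall>x\<in>E. \<exists>ts. set ts \<subseteq> E \<times> E \<and> tensor2_eq s (\<Delta> x) ts)"

definition subspace_sum :: "'a::ab_group_add set \<Rightarrow> 'a set \<Rightarrow> 'a set"
  where "subspace_sum V W = {v + w |v w. v \<in> V \<and> w \<in> W}"

definition action_span ::
  "('k::field \<Rightarrow> 'm::ab_group_add \<Rightarrow> 'm) \<Rightarrow> ('h \<Rightarrow> 'm \<Rightarrow> 'm) \<Rightarrow> 'h set \<Rightarrow> 'm set \<Rightarrow> 'm set"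
  where "action_span s act F E = module.span s {act f e |f e. f \<in> F \<and> e \<in> E}"

text \<open>
  For subspaces \<open>E \<le> W\<close>, the elements of \<open>W/E\<close> are the cosets of \<open>E\<close>;
  \<open>coset_lincomb s E B f\<close> is the linear combination of the cosets in the finite set \<open>B\<close>
  with coefficients \<open>f\<close>, formed on representatives.
\<close>

definition quotient_space :: "'a::ab_group_add set \<Rightarrow> 'a set \<Rightarrow> 'a set set"
  where "quotient_space W E = {{w + e |e. e \<in> E} |w. w \<in> W}"

definition coset_lincomb ::
  "('k::field \<Rightarrow> 'a::ab_group_add \<Rightarrow> 'a) \<Rightarrow> 'a set \<Rightarrow> 'a set set \<Rightarrow> ('a set \<Rightarrow> 'k) \<Rightarrow> 'a set"
  where "coset_lincomb s E B f =
    {(\<Sum>C\<in>B. s (f C) (r C)) + e |r e. (\<forall>C\<in>B. r C \<in> C) \<and> e \<in> E}"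

definition quotient_basis ::
  "('k::field \<Rightarrow> 'a::ab_group_add \<Rightarrow> 'a) \<Rightarrow> 'a set \<Rightarrow> 'a set \<Rightarrow> 'a set set \<Rightarrow> bool"
  where "quotient_basis s W E B \<longleftrightarrow>
    finite B \<and> B \<subseteq> quotient_space W E \<and>
    (\<forall>X\<in>quotient_space W E. \<exists>!f. (\<forall>C. C \<notin> B \<longrightarrow> f C = 0) \<and> X = coset_lincomb s E B f)"

text \<open>The dimension of \<open>W/E\<close>; meaningful only if this quotient is finite-dimensional.\<close>

definition quotient_dim ::
  "('k::field \<Rightarrow> 'a::ab_group_add \<Rightarrow> 'a) \<Rightarrow> 'a set \<Rightarrow> 'a set \<Rightarrow> nat"
  where "quotient_dim s W E = (THE n. \<exists>B. quotient_basis s W E B \<and> card B = n)"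


section \<open>Amenability\<close>

definition amenable ::
  "('k::field \<Rightarrow> 'h::ring_1 \<Rightarrow> 'h) \<Rightarrow> ('k \<Rightarrow> 'm::ab_group_add \<Rightarrow> 'm) \<Rightarrow>
   ('m \<Rightarrow> ('m \<times> 'm) list) \<Rightarrow> ('h \<Rightarrow> 'm \<Rightarrow> 'm) \<Rightarrow> bool"
  where
    "amenable sH sM \<Delta>M act \<longleftrightarrow>
       (\<forall>F. fin_dim_subspace sH F \<longrightarrow>
         (\<forall>\<epsilon>::real. \<epsilon> > 0 \<longrightarrow>
           (\<exists>E. fin_dim_subspace sM E \<and> subcoalgebra sM \<Delta>M E \<and>
             real (quotient_dim sM (subspace_sum E (action_span sM act F E)) E)
               < \<epsilon> * real (vector_space.dim sM E))))"

end

theory Submission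
  imports Defs "HOL-Library.Function_Algebras"
begin

text \<open>
  For groups one takes a Foelner set \<open>E \<subseteq> X\<close> and finds a Foelner set among the level sets
  \<open>{y. \<bar>E \<inter> q\<^sup>-\<^sup>1(y)\<bar> \<ge> t}\<close>, since summing over \<open>t\<close> gives both \<open>\<bar>E\<bar>\<close> and a lower bound for
  \<open>\<bar>F E\<bar>\<close>.  The level set maximizes \<open>\<bar>E \<inter> q\<^sup>-\<^sup>1(P)\<bar> - t \<bar>P\<bar>\<close> over \<open>P\<close>, and this makes sense
  for coalgebras: let \<open>P\<^sub>t(E)\<close> be a subcoalgebra \<open>P\<close> of \<open>Q\<close> maximizing \<open>dim E\<^sub>P - t dim P\<close>, where
  \<open>E\<^sub>P\<close> is the largest part of \<open>E\<close> whose coaction \<open>(id \<otimes> q) \<Delta>\<close> takes values in \<open>M \<otimes> P\<close>.  The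
  maximum is a convex function of \<open>t\<close> with slope \<open>- dim P\<^sub>t(E)\<close>, so that the integral of
  \<open>dim P\<^sub>t(E)\<close> over \<open>t\<close> is \<open>dim E\<close>.

  The point is that \<open>F P\<^sub>t(E) \<subseteq> P\<^sub>s(F E)\<close> for \<open>s < t\<close>, if \<open>F\<close> is spanned by the matrix
  coefficients of a finite-dimensional comodule \<open>V\<close>.  The matrix of coefficients acts on
  \<open>V \<otimes> M\<close> and \<open>V \<otimes> Q\<close>, and by the antipode and cocommutativity this action and its inverse
  preserve subcomodules; optimality of \<open>P\<^sub>t\<close> and \<open>P\<^sub>s\<close> extends to subcomodules of \<open>V \<otimes> Q\<close>.
  Consequently, if \<open>dim (F P) \<ge> K dim P\<close> for all finite-dimensional subcoalgebras \<open>P\<close> of \<open>Q\<close>,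
  then \<open>dim (F E) \<ge> K dim E\<close> for all those of \<open>M\<close>.
\<close>

section \<open>Finite-dimensional subspaces\<close>

context vector_space
begin

text \<open>\<open>fin_dim_subspace\<close> asks for a finite set spanning \<open>U\<close> itself;
  a maximal independent subset of \<open>U\<close> is one, being no larger than
  \<open>B\<close>.\<close>

lemma fin_dim_subspaceI: "subspace U \<Longrightarrow> finite B \<Longrightarrow> U \<subseteq> span B \<Longrightarrow> fin_dim_subspace scale U"
proof -
  assume U: "subspace U" and B: "finite B" "U \<subseteq> span B"
  obtain C where C: "C \<subseteq> U" "independent C" "U \<subseteq> span C"
    using maximal_independent_subset by blast
  have "finite C"
    using independent_span_bound[OF B(1) C(2)] C B by blast
  then show ?thesis
    unfolding fin_dim_subspace_def using U C span_minimal by (metis subset_antisym)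
qed

lemma fin_dim_subspaceD: "fin_dim_subspace scale U \<Longrightarrow> subspace U"
  by (simp add: fin_dim_subspace_def)

lemma fin_dim_span: "finite B \<Longrightarrow> fin_dim_subspace scale (span B)"
  by (auto simp: fin_dim_subspace_def)

lemma fin_dim_zero: "fin_dim_subspace scale {0}"
  by (rule fin_dim_subspaceI[of _ "{}"]) auto

lemma independent_subset_extend:
  assumes U: "fin_dim_subspace scale U" and A: "independent A" "A \<subseteq> U"
  obtains B where "finite B" "A \<subseteq> B" "B \<subseteq> U" "independent B" "span B = U" "card B = dim U"
proof -
  obtain X where X: "finite X" "span X = U" and sub: "subspace U"
    using U by (auto simp: fin_dim_subspace_def)
  obtain B where B: "A \<subseteq> B" "B \<subseteq> U" "independent B" "U \<subseteq> span B"
    using maximal_independent_subset_extend[OF A(2,1)] by blast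
  show ?thesis
  proof (rule that)
    show "finite B" using independent_span_bound[OF X(1) B(3)] X B by blast
    show "span B = U" using B sub span_minimal by blast
    show "card B = dim U" using B by (simp add: basis_card_eq_dim)
  qed (use B in auto)
qed

lemma fin_dim_basis:
  assumes "fin_dim_subspace scale U"
  obtains B where "finite B" "B \<subseteq> U" "independent B" "span B = U" "card B = dim U"
  using independent_subset_extend[OF assms independent_empty empty_subsetI] that by metis

lemma fin_dim_subset:
  assumes "fin_dim_subspace scale U" "subspace V" "V \<subseteq> U"
  shows "fin_dim_subspace scale V"
proof -
  obtain B where "finite B" "span B = U" using assms(1) by (auto simp: fin_dim_subspace_def)
  then show ?thesis using assms by (intro fin_dim_subspaceI[of V B]) auto
qed

lemma dim_subset_fin_dim:
  assumes "fin_dim_subspace scale U" "V \<subseteq> U"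
  shows "dim V \<le> dim U"
proof -
  obtain B where "finite B" "span B = U" "card B = dim U" using fin_dim_basis[OF assms(1)] .
  then show ?thesis using dim_le_card[of V B] assms by simp
qed

lemma subspace_eq_fin_dim:
  assumes U: "fin_dim_subspace scale U" and V: "subspace V" "V \<subseteq> U" and le: "dim U \<le> dim V"
  shows "V = U"
proof -
  obtain A where A: "A \<subseteq> V" "independent A" "span A = V" "card A = dim V"
    using fin_dim_basis[OF fin_dim_subset[OF U V]] by metis
  obtain B where B: "finite B" "A \<subseteq> B" "span B = U" "card B = dim U"
    using independent_subset_extend[OF U A(2)] A(1) V(2) by (metis order_trans)
  have "A = B" using B A le by (metis card_seteq)
  then show ?thesis using A B by simp
qed

lemma dim_zero_subspace: "dim {0} = 0"
  using dim_span_eq_card_independent[OF independent_empty] by simp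

lemma dim_eq_0_fin_dim:
  assumes "fin_dim_subspace scale U" "dim U = 0"
  shows "U = {0}"
  using subspace_eq_fin_dim[OF assms(1), of "{0}"] assms fin_dim_subspaceD[OF assms(1)] subspace_0
  by auto

lemma subspace_sum_superset:
  assumes "subspace V" "subspace W"
  shows "V \<subseteq> subspace_sum V W" "W \<subseteq> subspace_sum V W"
  unfolding subspace_sum_def using subspace_0[OF assms(1)] subspace_0[OF assms(2)]
  by (force, force)

lemma subspace_sum_minimal:
  "V \<subseteq> U \<Longrightarrow> W \<subseteq> U \<Longrightarrow> subspace U \<Longrightarrow> subspace_sum V W \<subseteq> U"
  unfolding subspace_sum_def by (auto intro: subspace_add)

lemma subspace_sum_span: "subspace_sum (span A) (span B) = span (A \<union> B)"
  by (simp add: subspace_sum_def span_Un)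

lemma fin_dim_subspace_sum:
  assumes "fin_dim_subspace scale V" "fin_dim_subspace scale W"
  shows "fin_dim_subspace scale (subspace_sum V W)"
  using assms by (metis fin_dim_basis subspace_sum_span fin_dim_span finite_Un)

text \<open>The coordinates of such a vector with respect to \<open>B\<close> vanish outside
  \<open>A\<close> and outside \<open>C\<close>.\<close>

lemma span_Int_span_eq_0:
  assumes ind: "independent B" and sub: "A \<subseteq> B" "C \<subseteq> B" "A \<inter> C = {}"
    and x: "x \<in> span A" "x \<in> span C"
  shows "x = 0"
proof -
  have "representation B x b = 0" for b
  proof -
    have "representation B x b = representation A x b" "representation B x b = representation C x b"
      using representation_extend[OF ind] sub x by metis+
    then show ?thesis
      using representation_ne_zero[of A x b] representation_ne_zero[of C x b] sub(3) by auto
  qed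
  moreover have "x \<in> span B" using x sub span_mono by blast
  ultimately show ?thesis
    using sum_nonzero_representation_eq[OF ind, of x] by simp
qed

end

section \<open>Dimension formulas for sums and images under a linear map\<close>

context vector_space_pair
begin

text \<open>The last hypothesis is injectivity of \<open>f\<close> modulo \<open>span C\<close>. The
  cardinality records that \<open>f\<close> is injective on \<open>B\<close> with images outside
  \<open>C\<close>, which dimension counts need.\<close>

lemma independent_Un_image:
  assumes f: "Vector_Spaces.linear s1 s2 f" and C: "vs2.independent C" "finite C"
    and "finite B" "vs1.independent B"
    and "\<And>x. x \<in> vs1.span B \<Longrightarrow> f x \<in> vs2.span C \<Longrightarrow> x = 0"
  shows "vs2.independent (C \<union> f ` B) \<and> card (C \<union> f ` B) = card C + card B"
  using assms(4-)
proof (induction B)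
  case empty
  then show ?case using C by simp
next
  case (insert b B)
  have b: "b \<notin> vs1.span B" and B: "vs1.independent B"
    using insert.prems(1) insert.hyps(2) by (auto simp: vs1.independent_insert)
  have IH: "vs2.independent (C \<union> f ` B)" "card (C \<union> f ` B) = card C + card B"
    using insert.IH[OF B] insert.prems(2) vs1.span_mono[of B "insert b B"] by auto
  have nin: "f b \<notin> vs2.span (C \<union> f ` B)"
  proof
    assume "f b \<in> vs2.span (C \<union> f ` B)"
    then obtain w u where w: "w \<in> vs2.span C" and u: "u \<in> vs1.span B" and eq: "f b = w + f u"
      unfolding vs2.span_Un linear_span_image[OF f] by auto
    have "b - u \<in> vs1.span (insert b B)"
      using u vs1.span_mono[of B "insert b B"] by (auto intro: vs1.span_diff vs1.span_base)
    moreover have "f (b - u) \<in> vs2.span C"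
      using w eq by (simp add: linear_diff[OF f])
    ultimately have "b - u = 0" using insert.prems(2) by blast
    then show False using b u by simp
  qed
  then have "f b \<notin> C \<union> f ` B" using vs2.span_superset by (meson subsetD)
  moreover have "vs2.independent (insert (f b) (C \<union> f ` B))"
    using nin IH(1) by (rule vs2.independent_insertI)
  ultimately show ?case
    using IH insert.hyps C by (simp add: card_insert_if)
qed

text \<open>Rank-nullity for \<open>f\<close> followed by the projection modulo \<open>W\<close>,
  without quotient spaces: a basis of \<open>W\<close> and the images of a basis of a complement of
  \<open>{u\<in>U. f u \<in> W}\<close> in \<open>U\<close> form a basis of the sum.\<close>

lemma dim_sum_image:
  assumes f: "Vector_Spaces.linear s1 s2 f"
    and U: "fin_dim_subspace s1 U" and W: "fin_dim_subspace s2 W"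
  shows "vs2.dim (subspace_sum W (f ` U)) + vs1.dim {u\<in>U. f u \<in> W} = vs2.dim W + vs1.dim U"
proof -
  let ?U0 = "{u\<in>U. f u \<in> W}"
  have subW: "vs2.subspace W" and subU: "vs1.subspace U"
    using U W by (auto simp: fin_dim_subspace_def)
  have "vs1.subspace ?U0"
    using vs1.subspace_inter[OF subU linear_subspace_linear_preimage[OF f subW]]
    by (simp add: Int_def)
  then have U0: "fin_dim_subspace s1 ?U0" by (auto intro: vs1.fin_dim_subset[OF U])
  obtain A where A: "finite A" "A \<subseteq> ?U0" "vs1.independent A" "vs1.span A = ?U0" "card A = vs1.dim ?U0"
    by (rule vs1.fin_dim_basis[OF U0])
  have "A \<subseteq> U" using A(2) by auto
  obtain B where B: "finite B" "A \<subseteq> B" "B \<subseteq> U" "vs1.independent B" "vs1.span B = U" "card B = vs1.dim U"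
    by (rule vs1.independent_subset_extend[OF U A(3) \<open>A \<subseteq> U\<close>])
  obtain C where C: "finite C" "C \<subseteq> W" "vs2.independent C" "vs2.span C = W" "card C = vs2.dim W"
    by (rule vs2.fin_dim_basis[OF W])
  have "vs2.independent (C \<union> f ` (B - A)) \<and> card (C \<union> f ` (B - A)) = card C + card (B - A)"
  proof (rule independent_Un_image[OF f C(3,1)])
    show "vs1.independent (B - A)" using B(4) vs1.independent_mono by blast
    fix x assume x: "x \<in> vs1.span (B - A)" "f x \<in> vs2.span C"
    then have "x \<in> U" using B vs1.span_mono[of "B - A" B] by blast
    then have "x \<in> vs1.span A" using x C A by auto
    then show "x = 0" using vs1.span_Int_span_eq_0[OF B(4), of A "B - A"] B x by blast
  qed (use B in auto)
  moreover have "subspace_sum W (f ` U) = vs2.span (C \<union> f ` (B - A))"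
  proof -
    \<comment> \<open>The images of \<open>A\<close> already lie in \<open>W\<close>, so that
      \<open>B - A\<close> suffices to span the sum.\<close>
    have "f ` A \<subseteq> vs2.span C" using A C by auto
    then have "vs2.span (C \<union> f ` (B - A)) = vs2.span (C \<union> f ` B)"
      unfolding vs2.span_eq
      using vs2.span_mono[of C "C \<union> f ` (B - A)"] vs2.span_superset[of "C \<union> f ` (B - A)"]
        vs2.span_superset[of "C \<union> f ` B"] by blast
    then show ?thesis
      using B C vs2.subspace_sum_span[of C "f ` B"] linear_span_image[OF f, of B] by simp
  qed
  ultimately have "vs2.dim (subspace_sum W (f ` U)) = card C + card (B - A)"
    using vs2.dim_span_eq_card_independent by simp
  moreover have "card (B - A) + card A = card B"
    using A B by (metis card_Diff_subset card_mono le_add_diff_inverse2)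
  ultimately show ?thesis using A B C by simp
qed

lemma fin_dim_image:
  assumes f: "Vector_Spaces.linear s1 s2 f" and U: "fin_dim_subspace s1 U"
  shows "fin_dim_subspace s2 (f ` U)"
proof -
  obtain B where "finite B" "vs1.span B = U" using U by (auto simp: fin_dim_subspace_def)
  then show ?thesis
    using vs2.fin_dim_span[of "f ` B"] linear_span_image[OF f, of B] by simp
qed

lemma rank_nullity:
  assumes f: "Vector_Spaces.linear s1 s2 f" and U: "fin_dim_subspace s1 U"
  shows "vs2.dim (f ` U) + vs1.dim {u\<in>U. f u = 0} = vs1.dim U"
proof -
  have "subspace_sum {0} (f ` U) = f ` U" by (auto simp: subspace_sum_def)
  then show ?thesis
    using dim_sum_image[OF f U vs2.fin_dim_zero] vs2.dim_zero_subspace by simp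
qed

end

section \<open>Powers of a vector space\<close>

abbreviation (input) power_scale :: "('k \<Rightarrow> 'a \<Rightarrow> 'a) \<Rightarrow> 'k \<Rightarrow> ('j \<Rightarrow> 'a) \<Rightarrow> 'j \<Rightarrow> 'a"
  where "power_scale s \<equiv> \<lambda>c z j. s c (z j)"

text \<open>This is \<open>V \<otimes> P\<close> for a space \<open>V\<close> with basis
  \<open>J\<close>, as families of coordinates. Vanishing outside \<open>J\<close> makes an element
  determined by its coordinates.\<close>

definition power_space :: "'j set \<Rightarrow> 'a::zero set \<Rightarrow> ('j \<Rightarrow> 'a) set"
  where "power_space J P = {z. (\<forall>j\<in>J. z j \<in> P) \<and> (\<forall>j. j \<notin> J \<longrightarrow> z j = 0)}"

lemma vector_space_power_scale:
  assumes "vector_space s" shows "vector_space (power_scale s)"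
proof -
  interpret vector_space s by fact
  show ?thesis
    by unfold_locales (auto simp: fun_eq_iff scale_right_distrib scale_left_distrib)
qed

lemma linear_power_component:
  assumes "vector_space s"
  shows "Vector_Spaces.linear (power_scale s) s (\<lambda>z. z j)"
  using assms by (auto simp: Vector_Spaces.linear_iff vector_space_power_scale)

lemma subspace_power_space:
  assumes "vector_space s" "module.subspace s P"
  shows "module.subspace (power_scale s) (power_space J P)"
proof -
  interpret vector_space s by fact
  interpret p: vector_space "power_scale s" by (rule vector_space_power_scale) fact
  show ?thesis
    by (rule p.subspaceI)
      (auto simp: power_space_def subspace_0 subspace_add subspace_scale assms(2))
qed

lemma power_space_empty: "power_space {} P = {0}"
  by (auto simp: power_space_def fun_eq_iff)

lemma power_space_insert_kernel:
  assumes "j \<notin> J" and "0 \<in> P"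
  shows "{z \<in> power_space (insert j J) P. z j = 0} = power_space J P"
  using assms by (auto simp: power_space_def)

text \<open>Induction on \<open>J\<close>: the coordinate \<open>j\<close> maps the power onto
  \<open>P\<close>, and its kernel is the power over the remaining indices.\<close>

lemma fin_dim_dim_power_space:
  assumes s: "vector_space s" and P: "fin_dim_subspace s P" and J: "finite J"
  shows "fin_dim_subspace (power_scale s) (power_space J P)"
    and "vector_space.dim (power_scale s) (power_space J P) = card J * vector_space.dim s P"
proof -
  interpret vector_space s by fact
  interpret p: vector_space "power_scale s" by (rule vector_space_power_scale) fact
  interpret pp: vector_space_pair s "power_scale s" ..
  interpret pq: vector_space_pair "power_scale s" s ..
  have sub: "subspace P" using P by (rule fin_dim_subspaceD)
  have 0: "0 \<in> P" using sub by (rule subspace_0)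
  have "fin_dim_subspace (power_scale s) (power_space J P) \<and>
      p.dim (power_space J P) = card J * dim P"
    using J
  proof (induction J)
    case empty
    then show ?case by (simp add: power_space_empty p.fin_dim_zero p.dim_zero_subspace)
  next
    case (insert j J)
    let ?i = "\<lambda>x k. if k = j then x else 0"
    have i: "Vector_Spaces.linear s (power_scale s) ?i"
      by (auto simp: Vector_Spaces.linear_iff fun_eq_iff p.vector_space_axioms vector_space_axioms)
    have "power_space (insert j J) P \<subseteq> subspace_sum (power_space J P) (?i ` P)"
    proof
      fix z assume z: "z \<in> power_space (insert j J) P"
      then have "z = z(j := 0) + ?i (z j)" "z(j := 0) \<in> power_space J P" "?i (z j) \<in> ?i ` P"
        using insert.hyps 0 by (auto simp: fun_eq_iff power_space_def)
      then show "z \<in> subspace_sum (power_space J P) (?i ` P)"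
        unfolding subspace_sum_def by blast
    qed
    then have fd: "fin_dim_subspace (power_scale s) (power_space (insert j J) P)"
      using insert.IH pp.fin_dim_image[OF i P] p.fin_dim_subspace_sum p.fin_dim_subset
        subspace_power_space[OF s sub] by blast
    have "(\<lambda>z. z j) ` power_space (insert j J) P = P"
    proof -
      have "x \<in> (\<lambda>z. z j) ` power_space (insert j J) P" if "x \<in> P" for x
        using that 0 by (intro image_eqI[of _ _ "?i x"]) (auto simp: power_space_def)
      then show ?thesis by (auto simp: power_space_def)
    qed
    then show ?case
      using pq.rank_nullity[OF linear_power_component[OF s, of j] fd] fd insert
        power_space_insert_kernel[OF insert.hyps(2) 0] by simp
  qed
  then show "fin_dim_subspace (power_scale s) (power_space J P)"
    "p.dim (power_space J P) = card J * dim P" by auto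
qed

section \<open>Quotient dimensions\<close>

context vector_space
begin

lemma quotient_space_eq_coset:
  assumes E: "subspace E" and X: "X \<in> quotient_space W E" and r: "r \<in> X"
  shows "X = {r + e |e. e \<in> E}"
proof -
  obtain w where w: "X = {w + e |e. e \<in> E}" using X by (auto simp: quotient_space_def)
  obtain e0 where e0: "r = w + e0" "e0 \<in> E" using r w by auto
  have "w + e = r + (e - e0)" "r + e = w + (e0 + e)" for e using e0 by (auto simp: algebra_simps)
  then show ?thesis unfolding w using E e0(2) subspace_add subspace_diff by blast
qed

lemma coset_eq_iff:
  assumes "subspace E"
  shows "{x + e |e. e \<in> E} = {y + e |e. e \<in> E} \<longleftrightarrow> x - y \<in> E"
proof
  assume "{x + e |e. e \<in> E} = {y + e |e. e \<in> E}"
  moreover have "x \<in> {x + e |e. e \<in> E}" using subspace_0[OF assms] by force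
  ultimately show "x - y \<in> E" by auto
next
  assume d: "x - y \<in> E"
  have "x + e = y + ((x - y) + e)" "y + e = x + (e - (x - y))" for e by (auto simp: algebra_simps)
  then show "{x + e |e. e \<in> E} = {y + e |e. e \<in> E}"
    using d assms subspace_add subspace_diff by blast
qed

text \<open>Another choice of representatives changes each term, hence the sum, by an element of
  \<open>E\<close>.\<close>

lemma coset_lincomb_eq:
  assumes E: "subspace E" and B: "B \<subseteq> quotient_space W E" and r: "\<And>C. C \<in> B \<Longrightarrow> r C \<in> C"
  shows "coset_lincomb scale E B f = {(\<Sum>C\<in>B. scale (f C) (r C)) + e |e. e \<in> E}"
proof -
  have "\<exists>e'\<in>E. (\<Sum>C\<in>B. scale (f C) (r' C)) + e = (\<Sum>C\<in>B. scale (f C) (r C)) + e'"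
    if r': "\<forall>C\<in>B. r' C \<in> C" and e: "e \<in> E" for r' e
  proof -
    have "r' C - r C \<in> E" if "C \<in> B" for C
    proof -
      have "C = {r C + e |e. e \<in> E}"
        by (rule quotient_space_eq_coset[OF E subsetD[OF B that] r[OF that]])
      then have "r' C \<in> {r C + e |e. e \<in> E}" using r' that by metis
      then show ?thesis by auto
    qed
    then have "(\<Sum>C\<in>B. scale (f C) (r' C - r C)) \<in> E"
      by (intro subspace_sum subspace_scale E)
    then have "(\<Sum>C\<in>B. scale (f C) (r' C)) - (\<Sum>C\<in>B. scale (f C) (r C)) + e \<in> E"
      using E e by (simp add: scale_right_diff_distrib sum_subtractf subspace_add)
    then show ?thesis by (intro bexI) (auto simp: algebra_simps)
  qed
  then show ?thesis
    unfolding coset_lincomb_def using r by (intro set_eqI iffI) (simp only: mem_Collect_eq, metis)+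
qed

text \<open>The elements that extend a basis of \<open>E\<close> to one of \<open>W\<close> are
  independent modulo \<open>E\<close>, which also keeps their cosets distinct.\<close>

lemma quotient_basisI:
  assumes A: "independent A" "span A = E" and fin: "finite R" and disj: "A \<inter> R = {}"
    and ind: "independent (A \<union> R)" and W: "span (A \<union> R) = W"
  shows "quotient_basis scale W E ((\<lambda>r. {r + e |e. e \<in> E}) ` R)"
    and "card ((\<lambda>r. {r + e |e. e \<in> E}) ` R) = card R"
proof -
  let ?c = "\<lambda>r. {r + e |e. e \<in> E}"
  have E: "subspace E" using A by auto
  have zero: "\<forall>r\<in>R. g r = 0" if "(\<Sum>r\<in>R. scale (g r) r) \<in> E" for g
  proof -
    have "(\<Sum>r\<in>R. scale (g r) r) \<in> span R"
      by (intro span_sum span_scale span_base)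
    then have "(\<Sum>r\<in>R. scale (g r) r) = 0"
      using span_Int_span_eq_0[OF ind, of A R] that A disj by auto
    then show ?thesis
      using independentD[OF independent_mono[OF ind, of R] fin] by auto
  qed
  have inj: "inj_on ?c R"
  proof (rule inj_onI, rule ccontr)
    fix x y assume xy: "x \<in> R" "y \<in> R" "?c x = ?c y" "x \<noteq> y"
    \<comment> \<open>If the two cosets were equal, the combination \<open>x - y\<close> with these
      coefficients would lie in \<open>E\<close>.\<close>
    let ?g = "\<lambda>r. if r = x then 1 else if r = y then - 1 else 0"
    have "(\<Sum>r\<in>R. scale (?g r) r) = (\<Sum>r\<in>{x, y}. scale (?g r) r)"
      using xy fin by (intro sum.mono_neutral_right) auto
    also have "\<dots> = x - y" using xy by simp
    finally show False
      using zero[of ?g] xy coset_eq_iff[OF E] by auto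
  qed
  show "card (?c ` R) = card R" using inj by (rule card_image)
  have sub: "?c ` R \<subseteq> quotient_space W E"
  proof
    fix X assume "X \<in> ?c ` R"
    then obtain x where "x \<in> R" "X = ?c x" by blast
    moreover from this have "x \<in> W" using W span_base by blast
    ultimately show "X \<in> quotient_space W E" unfolding quotient_space_def by blast
  qed
  define r where "r = the_inv_into R ?c"
  have r: "r (?c x) = x" if "x \<in> R" for x
    unfolding r_def by (rule the_inv_into_f_f[OF inj that])
  have lc: "coset_lincomb scale E (?c ` R) f = ?c (\<Sum>x\<in>R. scale (f (?c x)) x)" for f
  proof -
    have "r C \<in> C" if "C \<in> ?c ` R" for C
      using that r subspace_0[OF E] by force
    then have "coset_lincomb scale E (?c ` R) f = ?c (\<Sum>C\<in>?c ` R. scale (f C) (r C))"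
      using coset_lincomb_eq[OF E sub] by blast
    also have "(\<Sum>C\<in>?c ` R. scale (f C) (r C)) = (\<Sum>x\<in>R. scale (f (?c x)) x)"
      using r by (simp add: sum.reindex[OF inj])
    finally show ?thesis .
  qed
  have "\<exists>!f. (\<forall>C. C \<notin> ?c ` R \<longrightarrow> f C = 0) \<and> X = coset_lincomb scale E (?c ` R) f"
    if X: "X \<in> quotient_space W E" for X
  proof -
    obtain w where w: "w \<in> W" "X = ?c w" using X by (auto simp: quotient_space_def)
    obtain a v where av: "w = a + v" "a \<in> span A" "v \<in> span R"
      using w W by (auto simp: span_Un)
    obtain g where g: "v = (\<Sum>x\<in>R. scale (g x) x)"
      using av(3) by (auto simp: span_finite[OF fin])
    \<comment> \<open>Coefficient functions are total; the default 0 outside the basis is the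
      normalization under which \<open>quotient_basis\<close> demands uniqueness.\<close>
    let ?f = "\<lambda>C. if C \<in> ?c ` R then g (r C) else 0"
    have "(\<Sum>x\<in>R. scale (?f (?c x)) x) = v"
      unfolding g by (rule sum.cong) (auto simp: r)
    then have f: "X = coset_lincomb scale E (?c ` R) ?f"
      unfolding lc w(2) coset_eq_iff[OF E] using av A by simp
    show ?thesis
    proof (rule ex1I[of _ ?f])
      show "(\<forall>C. C \<notin> ?c ` R \<longrightarrow> ?f C = 0) \<and> X = coset_lincomb scale E (?c ` R) ?f"
        using f by simp
      fix f' assume f': "(\<forall>C. C \<notin> ?c ` R \<longrightarrow> f' C = 0) \<and> X = coset_lincomb scale E (?c ` R) f'"
      then have "(\<Sum>x\<in>R. scale (f' (?c x)) x) - (\<Sum>x\<in>R. scale (?f (?c x)) x) \<in> E"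
        using f unfolding lc coset_eq_iff[OF E, symmetric] by simp
      then have "(\<Sum>x\<in>R. scale (f' (?c x) - ?f (?c x)) x) \<in> E"
        by (simp only: scale_left_diff_distrib sum_subtractf)
      then have "\<forall>x\<in>R. f' (?c x) - ?f (?c x) = 0" by (rule zero)
      then show "f' = ?f" using f' by (intro ext) auto
    qed
  qed
  then show "quotient_basis scale W E (?c ` R)"
    unfolding quotient_basis_def using finite_imageI[OF fin] sub by simp
qed

text \<open>Representatives of the cosets in \<open>B\<close> together with a basis of
  \<open>E\<close> form a basis of \<open>W\<close>, so all quotient bases have the same
  cardinality.\<close>

lemma quotient_basis_card:
  assumes W: "fin_dim_subspace scale W" and E: "subspace E" "E \<subseteq> W"
    and B: "quotient_basis scale W E B"
  shows "card B + dim E = dim W"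
proof -
  let ?c = "\<lambda>r. {r + e |e. e \<in> E}"
  have subW: "subspace W" using W by (rule fin_dim_subspaceD)
  have fin: "finite B" and sub: "B \<subseteq> quotient_space W E"
    and ex1: "\<And>X. X \<in> quotient_space W E \<Longrightarrow>
      \<exists>!f. (\<forall>C. C \<notin> B \<longrightarrow> f C = 0) \<and> X = coset_lincomb scale E B f"
    using B by (auto simp: quotient_basis_def)
  obtain A where A: "finite A" "A \<subseteq> E" "independent A" "span A = E" "card A = dim E"
    by (rule fin_dim_basis[OF fin_dim_subset[OF W E]])
  have "\<forall>C\<in>B. \<exists>x. x \<in> W \<and> C = ?c x"
    using sub unfolding quotient_space_def by blast
  from bchoice[OF this] obtain r where "\<forall>C\<in>B. r C \<in> W \<and> C = ?c (r C)" ..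
  then have r: "\<And>C. C \<in> B \<Longrightarrow> r C \<in> W" "\<And>C. C \<in> B \<Longrightarrow> C = ?c (r C)" by auto
  have rC: "r C \<in> C" if "C \<in> B" for C
  proof -
    have "r C + 0 \<in> ?c (r C)" using subspace_0[OF E(1)] by blast
    then show ?thesis using r(2)[OF that] by simp
  qed
  have lc: "coset_lincomb scale E B f = ?c (\<Sum>C\<in>B. scale (f C) (r C))" for f
    by (rule coset_lincomb_eq[OF E(1) sub rC])
  \<comment> \<open>Independence of the representatives modulo \<open>E\<close>: otherwise the zero
    coset would have two coefficient functions.\<close>
  have zero: "\<forall>C\<in>B. g C = 0" if g: "(\<Sum>C\<in>B. scale (g C) (r C)) \<in> E" for g
  proof -
    have "?c 0 \<in> quotient_space W E" using subspace_0[OF subW] unfolding quotient_space_def by blast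
    note ex1[OF this]
    moreover have "?c 0 = coset_lincomb scale E B (\<lambda>C. if C \<in> B then g C else 0)"
    proof -
      have eq: "(\<Sum>C\<in>B. scale (if C \<in> B then g C else 0) (r C)) = (\<Sum>C\<in>B. scale (g C) (r C))"
        by (rule sum.cong) auto
      show ?thesis unfolding lc eq coset_eq_iff[OF E(1)] using subspace_neg[OF E(1) g] by simp
    qed
    moreover have "?c 0 = coset_lincomb scale E B (\<lambda>_. 0)"
      unfolding lc by simp
    ultimately have "(\<lambda>C. if C \<in> B then g C else 0) = (\<lambda>_. 0)"
      by (elim ex1E) (smt (verit))
    then show ?thesis by (metis (full_types))
  qed
  have inj: "inj_on r B"
  proof (rule inj_onI)
    fix C D assume "C \<in> B" "D \<in> B" "r C = r D"
    then show "C = D" using r(2)[of C] r(2)[of D] by simp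
  qed
  have ind: "independent (r ` B)"
  proof (rule independent_if_scalars_zero)
    fix f x assume f: "(\<Sum>x\<in>r ` B. scale (f x) x) = 0" and x: "x \<in> r ` B"
    have "(\<Sum>C\<in>B. scale (f (r C)) (r C)) \<in> E"
      using f subspace_0[OF E(1)] by (simp add: sum.reindex[OF inj])
    then show "f x = 0" using zero[of "f \<circ> r"] x by auto
  qed (use fin in simp)
  interpret p: vector_space_pair scale scale ..
  have "independent (A \<union> (\<lambda>x. x) ` r ` B) \<and> card (A \<union> (\<lambda>x. x) ` r ` B) = card A + card (r ` B)"
  proof (rule p.independent_Un_image[OF _ A(3,1) _ ind])
    show "Vector_Spaces.linear scale scale (\<lambda>x. x)" by (rule linear_ident)
    fix x assume x: "x \<in> span (r ` B)" "x \<in> span A"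
    obtain f where f: "x = (\<Sum>y\<in>r ` B. scale (f y) y)"
      using x(1) by (auto simp: span_finite fin)
    then have f': "x = (\<Sum>C\<in>B. scale (f (r C)) (r C))" by (simp add: sum.reindex[OF inj])
    then have "\<forall>C\<in>B. f (r C) = 0" using zero[of "f \<circ> r"] x(2) A(4) by simp
    then show "x = 0" unfolding f' by simp
  qed (use fin in simp)
  moreover have "span (A \<union> r ` B) = W"
  proof
    have "A \<union> r ` B \<subseteq> W" using A(2) E(2) r(1) by blast
    then show "span (A \<union> r ` B) \<subseteq> W" by (rule span_minimal[OF _ subW])
    show "W \<subseteq> span (A \<union> r ` B)"
    proof
      fix w assume "w \<in> W"
      then have "?c w \<in> quotient_space W E" unfolding quotient_space_def by blast
      then obtain f where "?c w = coset_lincomb scale E B f" using ex1 by (metis (no_types, lifting))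
      then have "w - (\<Sum>C\<in>B. scale (f C) (r C)) \<in> E"
        unfolding lc coset_eq_iff[OF E(1)] .
      then have "w - (\<Sum>C\<in>B. scale (f C) (r C)) \<in> span (A \<union> r ` B)"
        using A(4) span_mono[of A "A \<union> r ` B"] by blast
      moreover have "(\<Sum>C\<in>B. scale (f C) (r C)) \<in> span (A \<union> r ` B)"
        by (intro span_sum span_scale span_base) auto
      ultimately show "w \<in> span (A \<union> r ` B)" by (metis diff_add_cancel span_add)
    qed
  qed
  ultimately have "card A + card (r ` B) = dim W"
    using dim_span_eq_card_independent by (metis image_ident)
  then show ?thesis using A(5) card_image[OF inj] by simp
qed

text \<open>Existence of a quotient basis and the common cardinality make the definite description
  in \<open>quotient_dim\<close> denote. The additive form avoids truncated subtraction.\<close>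

lemma quotient_dim_eq:
  assumes W: "fin_dim_subspace scale W" and E: "subspace E" "E \<subseteq> W"
  shows "quotient_dim scale W E + dim E = dim W"
proof -
  obtain A where A: "finite A" "A \<subseteq> E" "independent A" "span A = E" "card A = dim E"
    by (rule fin_dim_basis[OF fin_dim_subset[OF W E]])
  obtain B where B: "finite B" "A \<subseteq> B" "B \<subseteq> W" "independent B" "span B = W" "card B = dim W"
    using independent_subset_extend[OF W A(3) order_trans[OF A(2) E(2)]] .
  have "A \<union> (B - A) = B" using B(2) by auto
  then have "quotient_basis scale W E ((\<lambda>r. {r + e |e. e \<in> E}) ` (B - A))"
    using quotient_basisI(1)[OF A(3,4), of "B - A" W] B by auto
  moreover have card: "card C = dim W - dim E" if "quotient_basis scale W E C" for C
    using quotient_basis_card[OF W E that] by simp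
  ultimately have "\<exists>C. quotient_basis scale W E C \<and> card C = dim W - dim E"
    by blast
  moreover have "n = dim W - dim E" if "\<exists>C. quotient_basis scale W E C \<and> card C = n" for n
    using that card by blast
  ultimately have "quotient_dim scale W E = dim W - dim E"
    unfolding quotient_dim_def by (rule the_equality)
  then show ?thesis using dim_subset_fin_dim[OF W E(2)] by simp
qed

end

section \<open>Tensors and linear functionals\<close>

definition functional :: "('k::field \<Rightarrow> 'a::ab_group_add \<Rightarrow> 'a) \<Rightarrow> ('a \<Rightarrow> 'k) \<Rightarrow> bool"
  where "functional s \<phi> \<longleftrightarrow>
    (\<forall>x y. \<phi> (x + y) = \<phi> x + \<phi> y) \<and> (\<forall>c x. \<phi> (s c x) = c * \<phi> x)"

text \<open>These are the rules under which \<open>\<beta>\<close> factors through the tensor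
  square. The target is any abelian group, so that values in the field, in a module and in the Hopf
  algebra are all covered.\<close>

definition balanced :: "('k \<Rightarrow> 'a \<Rightarrow> 'a) \<Rightarrow> ('a::ab_group_add \<Rightarrow> 'a \<Rightarrow> 'c::ab_group_add) \<Rightarrow> bool"
  where "balanced s \<beta> \<longleftrightarrow>
    (\<forall>a a' b. \<beta> (a + a') b = \<beta> a b + \<beta> a' b) \<and>
    (\<forall>a b b'. \<beta> a (b + b') = \<beta> a b + \<beta> a b') \<and>
    (\<forall>c a b. \<beta> (s c a) b = \<beta> a (s c b))"

lemma additive_zero:
  fixes f :: "'a::ab_group_add \<Rightarrow> 'b::ab_group_add"
  assumes "\<And>x y. f (x + y) = f x + f y"
  shows "f 0 = 0"
  using assms[of 0 0] by simp

lemma additive_sum_list: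
  fixes f :: "'a::ab_group_add \<Rightarrow> 'b::ab_group_add"
  assumes "\<And>x y. f (x + y) = f x + f y"
  shows "f (sum_list (map g xs)) = sum_list (map (\<lambda>x. f (g x)) xs)"
  by (induction xs) (simp_all add: assms additive_zero)

lemma additive_sum:
  fixes f :: "'a::ab_group_add \<Rightarrow> 'b::ab_group_add"
  assumes "\<And>x y. f (x + y) = f x + f y"
  shows "f (sum g A) = (\<Sum>x\<in>A. f (g x))"
  by (induction A rule: infinite_finite_induct) (simp_all add: assms additive_zero)

lemma functionalD:
  assumes "functional s \<phi>"
  shows "\<phi> (x + y) = \<phi> x + \<phi> y" "\<phi> (s c x) = c * \<phi> x"
  using assms by (auto simp: functional_def)

lemma functional_zero: "functional s \<phi> \<Longrightarrow> \<phi> 0 = 0"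
  by (rule additive_zero) (simp add: functionalD)

lemma functional_sum_list:
  "functional s \<phi> \<Longrightarrow> \<phi> (sum_list (map g xs)) = sum_list (map (\<lambda>x. \<phi> (g x)) xs)"
  by (rule additive_sum_list) (simp add: functionalD)

lemma functional_sum: "functional s \<phi> \<Longrightarrow> \<phi> (sum g A) = (\<Sum>x\<in>A. \<phi> (g x))"
  by (rule additive_sum) (simp add: functionalD)

lemma formal_sum_eq_eval:
  assumes "formal_sum_eq R xs ys"
    and "\<And>xs ys. R xs ys \<Longrightarrow> sum_list (map \<beta> xs) = (sum_list (map \<beta> ys) :: 'c::ab_group_add)"
  shows "sum_list (map \<beta> xs) = sum_list (map \<beta> ys)"
  using assms by (induction rule: formal_sum_eq.induct) (auto simp: add.commute)

text \<open>The universal property of the tensor square. Additivity in a group yields the value 0 on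
  the generator \<open>[(0, b)]\<close>.\<close>

lemma tensor2_eq_eval:
  assumes "tensor2_eq s xs ys" and \<beta>: "balanced s \<beta>"
  shows "(\<Sum>(a, b)\<leftarrow>xs. \<beta> a b) = (\<Sum>(a, b)\<leftarrow>ys. \<beta> a b)"
proof (rule formal_sum_eq_eval[OF assms(1)])
  have zero: "\<beta> 0 b = 0" for b
    by (rule additive_zero[of "\<lambda>a. \<beta> a b"]) (use \<beta> in \<open>simp add: balanced_def\<close>)
  show "(\<Sum>(a, b)\<leftarrow>xs. \<beta> a b) = (\<Sum>(a, b)\<leftarrow>ys. \<beta> a b)" if "tensor2_gen s xs ys" for xs ys
    using that \<beta> by cases (auto simp: balanced_def zero)
qed

lemma tensor3_eq_eval:
  assumes "tensor3_eq s xs ys"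
    and "\<And>d. balanced s (\<lambda>a b. \<tau> a b d)" and "\<And>a. balanced s (\<lambda>b d. \<tau> a b d)"
  shows "(\<Sum>(a, b, d)\<leftarrow>xs. \<tau> a b d) = (\<Sum>(a, b, d)\<leftarrow>ys. \<tau> a b d)"
proof (rule formal_sum_eq_eval[OF assms(1)])
  have zero: "\<tau> 0 b d = 0" for b d
    by (rule additive_zero[of "\<lambda>a. \<tau> a b d"]) (use assms(2) in \<open>simp add: balanced_def\<close>)
  show "(\<Sum>(a, b, d)\<leftarrow>xs. \<tau> a b d) = (\<Sum>(a, b, d)\<leftarrow>ys. \<tau> a b d)" if "tensor3_gen s xs ys" for xs ys
    using that assms(2,3) by cases (auto simp: balanced_def zero)
qed

lemma sum_list_map_concat:
  "sum_list (map f (concat xss)) = (\<Sum>xs\<leftarrow>xss. sum_list (map f xs))"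
  by (induction xss) auto

lemma sum_list_prod_swap:
  "(\<Sum>(a, b)\<leftarrow>[(b, a). (a, b) \<leftarrow> xs]. \<beta> a b) = (\<Sum>(a, b)\<leftarrow>xs. \<beta> b a)"
  by (induction xs) (auto split: prod.splits)

section \<open>Separation of vectors and tensors by linear functionals\<close>

context vector_space
begin

text \<open>Coordinates are taken with respect to an extension of \<open>B\<close> to a basis of the
  whole space, which makes them functionals defined everywhere.\<close>

lemma dual_basis:
  assumes "finite B" "independent B"
  obtains \<kappa> where "\<And>b. functional scale (\<kappa> b)"
    and "\<And>v. v \<in> span B \<Longrightarrow> (\<Sum>b\<in>B. scale (\<kappa> b v) b) = v"
    and "\<And>b b'. b \<in> B \<Longrightarrow> b' \<in> B \<Longrightarrow> \<kappa> b b' = (if b' = b then 1 else 0)"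
proof
  let ?B = "extend_basis B"
  let ?\<kappa> = "\<lambda>b v. representation ?B v b"
  have ind: "independent ?B" and sp: "span ?B = UNIV" and sub: "B \<subseteq> ?B"
    using extend_basis_superset[OF assms(2)] independent_extend_basis[OF assms(2)]
      span_extend_basis[OF assms(2)] by auto
  show "functional scale (?\<kappa> b)" for b
    by (simp add: functional_def representation_add[OF ind] representation_scale[OF ind] sp)
  show "(\<Sum>b\<in>B. scale (?\<kappa> b v) b) = v" if "v \<in> span B" for v
    using representation_extend[OF ind that sub] sum_representation_eq[OF assms(2) that assms(1)]
    by simp
  show "?\<kappa> b b' = (if b' = b then 1 else 0)" if "b \<in> B" "b' \<in> B" for b b'
    using representation_basis[OF ind, of b'] that sub by auto
qed

lemma functional_separates:
  assumes "\<And>\<phi>. functional scale \<phi> \<Longrightarrow> \<phi> x = \<phi> y"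
  shows "x = y"
proof -
  obtain B where B: "finite B" "B \<subseteq> span {x, y}" "independent B" "span B = span {x, y}"
      "card B = dim (span {x, y})"
    by (rule fin_dim_basis[OF fin_dim_span[of "{x, y}"]]) auto
  then have xy: "x \<in> span B" "y \<in> span B" by (simp_all add: span_base)
  obtain \<kappa> where \<kappa>: "\<And>b. functional scale (\<kappa> b)"
    "\<And>v. v \<in> span B \<Longrightarrow> (\<Sum>b\<in>B. scale (\<kappa> b v) b) = v"
    "\<And>b b'. b \<in> B \<Longrightarrow> b' \<in> B \<Longrightarrow> \<kappa> b b' = (if b' = b then 1 else 0)"
    by (rule dual_basis[OF B(1,3)]) blast
  have eq: "\<kappa> b x = \<kappa> b y" for b by (rule assms[OF \<kappa>(1)])
  show ?thesis by (rule HOL.trans[OF \<kappa>(2)[OF xy(1), symmetric, unfolded eq] \<kappa>(2)[OF xy(2)]])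
qed

lemma tensor2_eq_add_right:
  "tensor2_eq scale (map (\<lambda>g. (g, u g + w g)) gs) (map (\<lambda>g. (g, u g)) gs @ map (\<lambda>g. (g, w g)) gs)"
proof (induction gs)
  case Nil
  then show ?case by (simp add: formal_sum_eq.refl)
next
  case (Cons g gs)
  let ?U = "map (\<lambda>g. (g, u g)) gs" and ?W = "map (\<lambda>g. (g, w g)) gs"
  have "tensor2_eq scale ([(g, u g + w g)] @ map (\<lambda>g. (g, u g + w g)) gs)
      ([(g, u g), (g, w g)] @ (?U @ ?W))"
    by (intro formal_sum_eq.append Cons.IH formal_sum_eq.gen tensor2_gen.intros)
  moreover have "tensor2_eq scale ([(g, u g)] @ (([(g, w g)] @ ?U) @ ?W))
      ([(g, u g)] @ ((?U @ [(g, w g)]) @ ?W))"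
    by (intro formal_sum_eq.append formal_sum_eq.comm formal_sum_eq.refl)
  ultimately show ?case
    by (simp) (erule (1) formal_sum_eq.trans)
qed

lemma tensor2_eq_expand_left:
  "tensor2_eq scale [(\<Sum>g\<leftarrow>gs. scale (k g) g, b)] (map (\<lambda>g. (g, scale (k g) b)) gs)"
proof (induction gs)
  case Nil
  then show ?case by (simp add: formal_sum_eq.gen tensor2_gen.intros)
next
  case (Cons g gs)
  have "tensor2_eq scale [(scale (k g) g + (\<Sum>g\<leftarrow>gs. scale (k g) g), b)]
      ([(scale (k g) g, b)] @ [(\<Sum>g\<leftarrow>gs. scale (k g) g, b)])"
    by (simp, intro formal_sum_eq.gen tensor2_gen.intros)
  moreover have "tensor2_eq scale ([(scale (k g) g, b)] @ [(\<Sum>g\<leftarrow>gs. scale (k g) g, b)])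
      ([(g, scale (k g) b)] @ map (\<lambda>g. (g, scale (k g) b)) gs)"
    by (intro formal_sum_eq.append Cons.IH formal_sum_eq.gen tensor2_gen.intros)
  ultimately show ?case
    by simp (erule (1) formal_sum_eq.trans)
qed

text \<open>The generator for zero concerns the left factor; \<open>g \<otimes> 0\<close> reaches it
  by moving the scalar 0 across.\<close>

lemma tensor2_eq_zero_right: "tensor2_eq scale [] (map (\<lambda>g. (g, 0)) gs)"
proof (induction gs)
  case Nil
  then show ?case by (simp add: formal_sum_eq.refl)
next
  case (Cons g gs)
  have "tensor2_eq scale [(scale 0 g, 0)] [(g, scale 0 0)]"
    by (intro formal_sum_eq.gen tensor2_gen.intros)
  then have "tensor2_eq scale [] [(g, 0)]"
    by simp (metis formal_sum_eq.gen formal_sum_eq.sym formal_sum_eq.trans tensor2_gen.intros(1))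
  from formal_sum_eq.append[OF this Cons.IH] show ?case by simp
qed

text \<open>Expanding each left factor in \<open>gs\<close> and collecting terms leaves one right
  factor per element of \<open>gs\<close>.\<close>

lemma tensor2_eq_normal_form:
  assumes "\<And>a b. (a, b) \<in> set xs \<Longrightarrow> (\<Sum>g\<leftarrow>gs. scale (\<kappa> g a) g) = a"
  shows "tensor2_eq scale xs (map (\<lambda>g. (g, \<Sum>(a, b)\<leftarrow>xs. scale (\<kappa> g a) b)) gs)"
  using assms
proof (induction xs)
  case Nil
  then show ?case by (simp add: tensor2_eq_zero_right)
next
  case (Cons x xs)
  obtain a b where x: "x = (a, b)" by (cases x)
  have "(\<Sum>g\<leftarrow>gs. scale (\<kappa> g a) g) = a" using Cons.prems x by auto
  then have "tensor2_eq scale [x] (map (\<lambda>g. (g, scale (\<kappa> g a) b)) gs)"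
    using tensor2_eq_expand_left[of "\<lambda>g. \<kappa> g a" gs b] x by simp
  moreover have "tensor2_eq scale xs (map (\<lambda>g. (g, \<Sum>(a, b)\<leftarrow>xs. scale (\<kappa> g a) b)) gs)"
    using Cons.IH Cons.prems by auto
  ultimately have "tensor2_eq scale ([x] @ xs) (map (\<lambda>g. (g, scale (\<kappa> g a) b)) gs @
      map (\<lambda>g. (g, \<Sum>(a, b)\<leftarrow>xs. scale (\<kappa> g a) b)) gs)"
    by (rule formal_sum_eq.append)
  then show ?case
    using formal_sum_eq.sym[OF tensor2_eq_add_right[of "\<lambda>g. scale (\<kappa> g a) b"
          "\<lambda>g. \<Sum>(a, b)\<leftarrow>xs. scale (\<kappa> g a) b" gs]] x
    by simp (erule (1) formal_sum_eq.trans)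
qed

text \<open>Both sums have a normal form over a common basis of their left factors, and the right
  factors agree since functionals separate vectors. Equality of tensors is thereby tested on
  products of functionals.\<close>

lemma tensor2_eqI:
  assumes "\<And>\<phi> \<psi>. functional scale \<phi> \<Longrightarrow> functional scale \<psi> \<Longrightarrow>
      (\<Sum>(a, b)\<leftarrow>xs. \<phi> a * \<psi> b) = (\<Sum>(a, b)\<leftarrow>ys. \<phi> a * \<psi> b)"
  shows "tensor2_eq scale xs ys"
proof -
  let ?X = "fst ` set (xs @ ys)"
  obtain B where B: "finite B" "B \<subseteq> span ?X" "independent B" "span B = span ?X" "card B = dim (span ?X)"
    by (rule fin_dim_basis[OF fin_dim_span[of ?X]]) auto
  obtain gs where gs: "set gs = B" "distinct gs" using finite_distinct_list[OF B(1)] by auto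
  obtain \<kappa> where \<kappa>: "\<And>b. functional scale (\<kappa> b)"
    "\<And>v. v \<in> span B \<Longrightarrow> (\<Sum>b\<in>B. scale (\<kappa> b v) b) = v"
    "\<And>b b'. b \<in> B \<Longrightarrow> b' \<in> B \<Longrightarrow> \<kappa> b b' = (if b' = b then 1 else 0)"
    by (rule dual_basis[OF B(1,3)]) blast
  have "(\<Sum>g\<leftarrow>gs. scale (\<kappa> g a) g) = a" if "(a, b) \<in> set (xs @ ys)" for a b
  proof -
    have "a \<in> fst ` set (xs @ ys)" using that by (rule rev_image_eqI) simp
    then have "a \<in> span B" unfolding B(4) by (rule span_base)
    from \<kappa>(2)[OF this] show ?thesis using gs by (simp add: sum_list_distinct_conv_sum_set)
  qed
  then have "tensor2_eq scale xs (map (\<lambda>g. (g, \<Sum>(a, b)\<leftarrow>xs. scale (\<kappa> g a) b)) gs)"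
    "tensor2_eq scale ys (map (\<lambda>g. (g, \<Sum>(a, b)\<leftarrow>ys. scale (\<kappa> g a) b)) gs)"
    by (auto intro!: tensor2_eq_normal_form)
  moreover have "(\<Sum>(a, b)\<leftarrow>xs. scale (\<kappa> g a) b) = (\<Sum>(a, b)\<leftarrow>ys. scale (\<kappa> g a) b)" for g
  proof (rule functional_separates)
    fix \<psi> assume \<psi>: "functional scale \<psi>"
    show "\<psi> (\<Sum>(a, b)\<leftarrow>xs. scale (\<kappa> g a) b) = \<psi> (\<Sum>(a, b)\<leftarrow>ys. scale (\<kappa> g a) b)"
      using assms[OF \<kappa>(1)[of g] \<psi>]
      by (simp add: functional_sum_list[OF \<psi>] functionalD[OF \<psi>] case_prod_unfold)
  qed
  ultimately show ?thesis
    by (simp only:) (erule formal_sum_eq.trans, erule formal_sum_eq.sym)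
qed

end

section \<open>Contractions of the coproduct\<close>

context coalgebra
begin

text \<open>The map \<open>(\<phi> \<otimes> id) \<Delta>\<close>. As \<open>\<phi>\<close> varies,
  stability under these maps describes left coideals.\<close>

definition left_contr :: "('a \<Rightarrow> 'k) \<Rightarrow> 'a \<Rightarrow> 'a"
  where "left_contr \<phi> x = (\<Sum>(a, b)\<leftarrow>\<Delta> x. scale (\<phi> a) b)"

definition right_contr :: "('a \<Rightarrow> 'k) \<Rightarrow> 'a \<Rightarrow> 'a"
  where "right_contr \<phi> x = (\<Sum>(a, b)\<leftarrow>\<Delta> x. scale (\<phi> b) a)"

lemma functional_counit: "functional scale \<epsilon>"
  using counit_linear unfolding Vector_Spaces.linear_iff functional_def by simp

lemma left_contr_counit: "left_contr \<epsilon> x = x"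
  by (simp add: left_contr_def counit_left)

lemma right_contr_counit: "right_contr \<epsilon> x = x"
  by (simp add: right_contr_def counit_right)

lemma eval_comult_add:
  assumes "balanced scale \<beta>"
  shows "(\<Sum>(a, b)\<leftarrow>\<Delta> (x + y). \<beta> a b) = (\<Sum>(a, b)\<leftarrow>\<Delta> x. \<beta> a b) + (\<Sum>(a, b)\<leftarrow>\<Delta> y. \<beta> a b)"
  using tensor2_eq_eval[OF comult_add assms, of x y] by simp

lemma eval_comult_scale:
  assumes "balanced scale \<beta>"
  shows "(\<Sum>(a, b)\<leftarrow>\<Delta> (scale c x). \<beta> a b) = (\<Sum>(a, b)\<leftarrow>\<Delta> x. \<beta> (scale c a) b)"
  using tensor2_eq_eval[OF comult_scale assms, of c x]
  by (simp add: case_prod_unfold sum_list_map_concat comp_def)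

lemma eval_coassoc:
  assumes "\<And>d. balanced scale (\<lambda>a b. \<tau> a b d)" and "\<And>a. balanced scale (\<lambda>b d. \<tau> a b d)"
  shows "(\<Sum>(a, b)\<leftarrow>\<Delta> x. \<Sum>(a\<^sub>1, a\<^sub>2)\<leftarrow>\<Delta> a. \<tau> a\<^sub>1 a\<^sub>2 b) =
    (\<Sum>(a, b)\<leftarrow>\<Delta> x. \<Sum>(b\<^sub>1, b\<^sub>2)\<leftarrow>\<Delta> b. \<tau> a b\<^sub>1 b\<^sub>2)"
  using tensor3_eq_eval[OF coassoc assms, of x]
  by (simp add: case_prod_unfold sum_list_map_concat comp_def)

lemma balanced_functional:
  "functional scale \<phi> \<Longrightarrow> functional scale \<psi> \<Longrightarrow> balanced scale (\<lambda>a b. \<phi> a * \<psi> b)"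
  by (simp add: balanced_def functionalD algebra_simps)

lemma functional_eval_comult:
  assumes "functional scale \<phi>" "functional scale \<psi>"
  shows "functional scale (\<lambda>x. \<Sum>(a, b)\<leftarrow>\<Delta> x. \<phi> a * \<psi> b)"
  unfolding functional_def
proof (intro conjI allI)
  note bal = balanced_functional[OF assms]
  show "(\<Sum>(a, b)\<leftarrow>\<Delta> (x + y). \<phi> a * \<psi> b) = (\<Sum>(a, b)\<leftarrow>\<Delta> x. \<phi> a * \<psi> b) + (\<Sum>(a, b)\<leftarrow>\<Delta> y. \<phi> a * \<psi> b)" for x y
    by (rule eval_comult_add[OF bal])
  show "(\<Sum>(a, b)\<leftarrow>\<Delta> (scale c x). \<phi> a * \<psi> b) = c * (\<Sum>(a, b)\<leftarrow>\<Delta> x. \<phi> a * \<psi> b)" for c x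
    unfolding eval_comult_scale[OF bal]
    by (simp add: functionalD[OF assms(1)] sum_list_const_mult[symmetric] case_prod_unfold mult.assoc)
qed

lemma balanced_left_contr: "functional scale \<phi> \<Longrightarrow> balanced scale (\<lambda>a b. scale (\<phi> a) b)"
  by (simp add: balanced_def functionalD scale_left_distrib scale_right_distrib mult.commute)

lemma balanced_right_contr: "functional scale \<phi> \<Longrightarrow> balanced scale (\<lambda>a b. scale (\<phi> b) a)"
  by (simp add: balanced_def functionalD scale_left_distrib scale_right_distrib mult.commute)

lemma scale_sum_list: "scale c (sum_list (map f xs)) = (\<Sum>x\<leftarrow>xs. scale c (f x))"
  by (rule additive_sum_list) (simp add: scale_right_distrib)

lemma linear_left_contr:
  assumes "functional scale \<phi>"
  shows "Vector_Spaces.linear scale scale (left_contr \<phi>)"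
  unfolding Vector_Spaces.linear_iff left_contr_def
  using eval_comult_add[OF balanced_left_contr[OF assms]]
    eval_comult_scale[OF balanced_left_contr[OF assms]]
  by (simp add: vector_space_axioms functionalD[OF assms] case_prod_unfold scale_sum_list)

lemma linear_right_contr:
  assumes "functional scale \<phi>"
  shows "Vector_Spaces.linear scale scale (right_contr \<phi>)"
  unfolding Vector_Spaces.linear_iff right_contr_def
  using eval_comult_add[OF balanced_right_contr[OF assms]]
    eval_comult_scale[OF balanced_right_contr[OF assms]]
  by (simp add: vector_space_axioms functionalD[OF assms] case_prod_unfold scale_sum_list mult.commute)

lemma functional_left_contr:
  "functional scale \<psi> \<Longrightarrow> \<psi> (left_contr \<phi> x) = (\<Sum>(a, b)\<leftarrow>\<Delta> x. \<phi> a * \<psi> b)"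
  unfolding left_contr_def
  by (simp add: functional_sum_list functionalD case_prod_unfold)

lemma functional_right_contr:
  "functional scale \<psi> \<Longrightarrow> \<psi> (right_contr \<phi> x) = (\<Sum>(a, b)\<leftarrow>\<Delta> x. \<psi> a * \<phi> b)"
  unfolding right_contr_def
  by (simp add: functional_sum_list functionalD case_prod_unfold mult.commute)

lemma eval_coassoc_functional:
  assumes \<phi>: "functional scale \<phi>" and \<psi>: "functional scale \<psi>" and \<chi>: "functional scale \<chi>"
  shows "(\<Sum>(a, b)\<leftarrow>\<Delta> x. (\<Sum>(a\<^sub>1, a\<^sub>2)\<leftarrow>\<Delta> a. \<phi> a\<^sub>1 * \<psi> a\<^sub>2) * \<chi> b) =
    (\<Sum>(a, b)\<leftarrow>\<Delta> x. \<phi> a * (\<Sum>(b\<^sub>1, b\<^sub>2)\<leftarrow>\<Delta> b. \<psi> b\<^sub>1 * \<chi> b\<^sub>2))"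
proof -
  have "(\<Sum>(a, b)\<leftarrow>\<Delta> x. \<Sum>(a\<^sub>1, a\<^sub>2)\<leftarrow>\<Delta> a. \<phi> a\<^sub>1 * \<psi> a\<^sub>2 * \<chi> b) =
      (\<Sum>(a, b)\<leftarrow>\<Delta> x. \<Sum>(b\<^sub>1, b\<^sub>2)\<leftarrow>\<Delta> b. \<phi> a * \<psi> b\<^sub>1 * \<chi> b\<^sub>2)"
    using \<phi> \<psi> \<chi> by (intro eval_coassoc) (simp_all add: balanced_def functionalD algebra_simps)
  then show ?thesis
    by (simp add: case_prod_unfold sum_list_const_mult[symmetric] sum_list_mult_const[symmetric]
        mult.assoc)
qed

text \<open>Composition of contractions is contraction by the convolution product of the
  functionals; testing with \<open>\<chi>\<close> reduces this to coassociativity.\<close>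

lemma left_contr_left_contr:
  assumes "functional scale \<phi>" "functional scale \<psi>"
  shows "left_contr \<psi> (left_contr \<phi> x) = left_contr (\<lambda>y. \<Sum>(a, b)\<leftarrow>\<Delta> y. \<phi> a * \<psi> b) x"
proof (rule functional_separates)
  fix \<chi> assume \<chi>: "functional scale \<chi>"
  have "\<chi> (left_contr \<psi> (left_contr \<phi> x)) = (\<Sum>(a, b)\<leftarrow>\<Delta> x. \<phi> a * (\<Sum>(b\<^sub>1, b\<^sub>2)\<leftarrow>\<Delta> b. \<psi> b\<^sub>1 * \<chi> b\<^sub>2))"
    unfolding functional_left_contr[OF \<chi>]
    by (rule functional_left_contr[OF functional_eval_comult[OF assms(2) \<chi>]])
  also have "\<dots> = \<chi> (left_contr (\<lambda>y. \<Sum>(a, b)\<leftarrow>\<Delta> y. \<phi> a * \<psi> b) x)"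
    unfolding functional_left_contr[OF \<chi>]
    using eval_coassoc_functional[OF assms \<chi>, of x] by simp
  finally show "\<chi> (left_contr \<psi> (left_contr \<phi> x)) = \<dots>" .
qed

lemma subcoalgebra_left_contr:
  assumes E: "subcoalgebra scale \<Delta> E" and \<phi>: "functional scale \<phi>" and x: "x \<in> E"
  shows "left_contr \<phi> x \<in> E"
proof -
  obtain ts where ts: "set ts \<subseteq> E \<times> E" "tensor2_eq scale (\<Delta> x) ts" and sub: "subspace E"
    using E x by (auto simp: subcoalgebra_def)
  have "left_contr \<phi> x = (\<Sum>(a, b)\<leftarrow>ts. scale (\<phi> a) b)"
    unfolding left_contr_def by (rule tensor2_eq_eval[OF ts(2) balanced_left_contr[OF \<phi>]])
  also have "\<dots> \<in> E"
    using ts(1) by (induction ts) (auto simp: subspace_0[OF sub] subspace_add[OF sub] subspace_scale[OF sub])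
  finally show ?thesis .
qed

lemma subcoalgebra_right_contr:
  assumes E: "subcoalgebra scale \<Delta> E" and \<phi>: "functional scale \<phi>" and x: "x \<in> E"
  shows "right_contr \<phi> x \<in> E"
proof -
  obtain ts where ts: "set ts \<subseteq> E \<times> E" "tensor2_eq scale (\<Delta> x) ts" and sub: "subspace E"
    using E x by (auto simp: subcoalgebra_def)
  have "right_contr \<phi> x = (\<Sum>(a, b)\<leftarrow>ts. scale (\<phi> b) a)"
    unfolding right_contr_def by (rule tensor2_eq_eval[OF ts(2) balanced_right_contr[OF \<phi>]])
  also have "\<dots> \<in> E"
    using ts(1) by (induction ts) (auto simp: subspace_0[OF sub] subspace_add[OF sub] subspace_scale[OF sub])
  finally show ?thesis .
qed

text \<open>The right factors of the coproduct can be taken in \<open>B\<close>, because all left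
  contractions lie in its span; the left factors are then right contractions by the dual
  basis.\<close>

lemma comult_eq_basis:
  assumes V: "finite B" "\<And>\<phi>. functional scale \<phi> \<Longrightarrow> left_contr \<phi> x \<in> span B"
    and \<kappa>: "\<And>b. functional scale (\<kappa> b)" "\<And>v. v \<in> span B \<Longrightarrow> (\<Sum>b\<in>B. scale (\<kappa> b v) b) = v"
    and bs: "set bs = B" "distinct bs"
  shows "tensor2_eq scale (\<Delta> x) (map (\<lambda>k. (right_contr (\<kappa> k) x, k)) bs)"
proof (rule tensor2_eqI)
  fix \<phi> \<psi> assume \<phi>: "functional scale \<phi>" and \<psi>: "functional scale \<psi>"
  have "(\<Sum>(a, b)\<leftarrow>\<Delta> x. \<phi> a * \<psi> b) = \<psi> (\<Sum>k\<in>B. scale (\<kappa> k (left_contr \<phi> x)) k)"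
    using \<kappa>(2)[OF V(2)[OF \<phi>]] functional_left_contr[OF \<psi>] by simp
  also have "\<dots> = (\<Sum>k\<in>B. \<phi> (right_contr (\<kappa> k) x) * \<psi> k)"
    by (simp add: functional_sum[OF \<psi>] functionalD[OF \<psi>] functional_left_contr[OF \<kappa>(1)]
        functional_right_contr[OF \<phi>])
  also have "\<dots> = (\<Sum>(a, b)\<leftarrow>map (\<lambda>k. (right_contr (\<kappa> k) x, k)) bs. \<phi> a * \<psi> b)"
    using bs by (simp add: sum_list_distinct_conv_sum_set comp_def)
  finally show "(\<Sum>(a, b)\<leftarrow>\<Delta> x. \<phi> a * \<psi> b) = \<dots>" .
qed

text \<open>Stability under left contractions puts the right factors of the coproduct into
  \<open>P\<close>; the left factors are then right contractions and lie in \<open>P\<close> as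
  well.\<close>

lemma subcoalgebraI:
  assumes P: "fin_dim_subspace scale P"
    and l: "\<And>\<phi> x. functional scale \<phi> \<Longrightarrow> x \<in> P \<Longrightarrow> left_contr \<phi> x \<in> P"
    and r: "\<And>\<phi> x. functional scale \<phi> \<Longrightarrow> x \<in> P \<Longrightarrow> right_contr \<phi> x \<in> P"
  shows "subcoalgebra scale \<Delta> P"
  unfolding subcoalgebra_def
proof (intro conjI ballI fin_dim_subspaceD[OF P])
  fix x assume x: "x \<in> P"
  obtain B where B: "finite B" "B \<subseteq> P" "independent B" "span B = P" "card B = dim P"
    by (rule fin_dim_basis[OF P])
  obtain \<kappa> where \<kappa>: "\<And>b. functional scale (\<kappa> b)"
    "\<And>v. v \<in> span B \<Longrightarrow> (\<Sum>b\<in>B. scale (\<kappa> b v) b) = v"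
    "\<And>b b'. b \<in> B \<Longrightarrow> b' \<in> B \<Longrightarrow> \<kappa> b b' = (if b' = b then 1 else 0)"
    by (rule dual_basis[OF B(1,3)]) blast
  obtain bs where bs: "set bs = B" "distinct bs" using finite_distinct_list[OF B(1)] by auto
  have "tensor2_eq scale (\<Delta> x) (map (\<lambda>k. (right_contr (\<kappa> k) x, k)) bs)"
    using l x B(4) by (intro comult_eq_basis[OF B(1) _ \<kappa>(1,2) bs]) auto
  moreover have "set (map (\<lambda>k. (right_contr (\<kappa> k) x, k)) bs) \<subseteq> P \<times> P"
    using r[OF \<kappa>(1) x] B(2) bs(1) by auto
  ultimately show "\<exists>ts. set ts \<subseteq> P \<times> P \<and> tensor2_eq scale (\<Delta> x) ts" by blast
qed

text \<open>Local finiteness of comodules. All left contractions of \<open>x\<close> lie in the span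
  of the finitely many right factors of \<open>\<Delta> x\<close>; the counit shows that
  \<open>x\<close> is one of them, and convolution that their span is stable.\<close>

lemma fin_dim_left_contr_closed:
  assumes X: "finite X"
  obtains V where "fin_dim_subspace scale V" "X \<subseteq> V"
    "\<And>\<phi> v. functional scale \<phi> \<Longrightarrow> v \<in> V \<Longrightarrow> left_contr \<phi> v \<in> V"
proof
  let ?G = "{left_contr \<phi> x |\<phi> x. functional scale \<phi> \<and> x \<in> X}"
  let ?Y = "\<Union>x\<in>X. snd ` set (\<Delta> x)"
  have "left_contr \<phi> x \<in> span ?Y" if "x \<in> X" for \<phi> x
  proof -
    have "(\<Sum>(a, b)\<leftarrow>ts. scale (\<phi> a) b) \<in> span ?Y" if "set ts \<subseteq> set (\<Delta> x)" for ts
      using that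
    proof (induction ts)
      case (Cons t ts)
      have "snd t \<in> ?Y" using Cons.prems \<open>x \<in> X\<close> by auto
      then have "scale (\<phi> (fst t)) (snd t) \<in> span ?Y" by (intro span_scale span_base)
      then show ?case
        using Cons by (simp add: case_prod_unfold span_add)
    qed (simp add: span_zero)
    then show ?thesis by (simp add: left_contr_def)
  qed
  then have "span ?G \<subseteq> span ?Y" by (intro span_minimal) auto
  then show "fin_dim_subspace scale (span ?G)"
    using X by (intro fin_dim_subspaceI[OF _ _ \<open>span ?G \<subseteq> span ?Y\<close>]) auto
  show "X \<subseteq> span ?G"
  proof
    fix x assume "x \<in> X"
    then have "left_contr \<epsilon> x \<in> ?G" using functional_counit by blast
    then show "x \<in> span ?G" by (simp add: left_contr_counit span_base)
  qed
  fix \<psi> v assume \<psi>: "functional scale \<psi>" and v: "v \<in> span ?G"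
  interpret l: Vector_Spaces.linear scale scale "left_contr \<psi>" by (rule linear_left_contr[OF \<psi>])
  have "left_contr \<psi> g \<in> span ?G" if "g \<in> ?G" for g
  proof -
    obtain \<phi> x where g: "g = left_contr \<phi> x" "functional scale \<phi>" "x \<in> X" using \<open>g \<in> ?G\<close> by blast
    then have "left_contr \<psi> g \<in> ?G"
      using left_contr_left_contr[OF g(2) \<psi>] functional_eval_comult[OF g(2) \<psi>] by blast
    then show ?thesis by (rule span_base)
  qed
  then have "left_contr \<psi> ` ?G \<subseteq> span ?G" by blast
  then have "span (left_contr \<psi> ` ?G) \<subseteq> span ?G" by (rule span_minimal) simp
  then show "left_contr \<psi> v \<in> span ?G" using v l.span_image[of ?G] by blast
qed

text \<open>The matrix coefficients of a finite-dimensional left coideal with basis \<open>bs\<close>.\<close>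

definition coefficient_matrix :: "'a list \<Rightarrow> ('a \<Rightarrow> 'a \<Rightarrow> 'a) \<Rightarrow> bool"
  where "coefficient_matrix bs c \<longleftrightarrow> distinct bs \<and>
    (\<forall>j\<in>set bs. \<forall>k\<in>set bs.
      tensor2_eq scale (\<Delta> (c j k)) (map (\<lambda>l. (c j l, c l k)) bs) \<and>
      \<epsilon> (c j k) = (if j = k then 1 else 0))"

text \<open>The matrix is defined by \<open>\<Delta> j = \<Sum>\<^sub>k c j k \<otimes> k\<close>,
  and its coproducts come from coassociativity. The counit writes \<open>j\<close> as a combination
  of the \<open>c j k\<close>, so the span of the coefficients contains the left coideal.\<close>

lemma coefficient_matrix_exists:
  assumes X: "finite X"
  obtains bs c where "coefficient_matrix bs c" "X \<subseteq> span {c j k |j k. j \<in> set bs \<and> k \<in> set bs}"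
proof -
  obtain V where V: "fin_dim_subspace scale V" "X \<subseteq> V"
    "\<And>\<phi> v. functional scale \<phi> \<Longrightarrow> v \<in> V \<Longrightarrow> left_contr \<phi> v \<in> V"
    by (rule fin_dim_left_contr_closed[OF X]) blast
  obtain B where B: "finite B" "B \<subseteq> V" "independent B" "span B = V" "card B = dim V"
    by (rule fin_dim_basis[OF V(1)])
  obtain \<kappa> where \<kappa>: "\<And>b. functional scale (\<kappa> b)"
    "\<And>v. v \<in> span B \<Longrightarrow> (\<Sum>b\<in>B. scale (\<kappa> b v) b) = v"
    "\<And>b b'. b \<in> B \<Longrightarrow> b' \<in> B \<Longrightarrow> \<kappa> b b' = (if b' = b then 1 else 0)"
    by (rule dual_basis[OF B(1,3)]) blast
  let ?c = "\<lambda>j k. right_contr (\<kappa> k) j"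
  obtain bs where bs: "set bs = B" "distinct bs" using finite_distinct_list[OF B(1)] by auto
  have comult: "tensor2_eq scale (\<Delta> j) (map (\<lambda>k. (?c j k, k)) bs)"
    if "j \<in> B" for j
    using V(3) B(2,4) that by (intro comult_eq_basis[OF B(1) _ \<kappa>(1,2) bs]) auto
  have eval: "(\<Sum>(a, b)\<leftarrow>\<Delta> j. \<beta> a b) = (\<Sum>k\<in>B. \<beta> (?c j k) k)"
    if "j \<in> B" "balanced scale \<beta>" for j and \<beta> :: "'a \<Rightarrow> 'a \<Rightarrow> 'c::ab_group_add"
    using tensor2_eq_eval[OF comult[OF that(1)] that(2)] bs
    by (simp add: sum_list_distinct_conv_sum_set comp_def)
  show ?thesis
  proof (rule that[of bs ?c], unfold coefficient_matrix_def bs(1), intro conjI ballI bs(2))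
    show "X \<subseteq> span {?c j k |j k. j \<in> B \<and> k \<in> B}"
    proof -
      have "j \<in> span {?c j k |j k. j \<in> B \<and> k \<in> B}" if j: "j \<in> B" for j
      proof -
        have "j = (\<Sum>k\<in>B. scale (\<epsilon> k) (?c j k))"
          using counit_right[of j] eval[OF j balanced_right_contr[OF functional_counit]] by simp
        also have "\<dots> \<in> span {?c j k |j k. j \<in> B \<and> k \<in> B}"
          using j by (intro span_sum span_scale span_base) blast
        finally show ?thesis .
      qed
      then have "B \<subseteq> span {?c j k |j k. j \<in> B \<and> k \<in> B}" by blast
      then have "span B \<subseteq> span {?c j k |j k. j \<in> B \<and> k \<in> B}" by (rule span_minimal) simp
      then show ?thesis using V(2) B(4) by blast
    qed
    show "\<epsilon> (?c j k) = (if j = k then 1 else 0)" if "j \<in> B" "k \<in> B" for j k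
    proof -
      have "\<epsilon> (?c j k) = \<kappa> k (left_contr \<epsilon> j)"
        by (simp add: functional_right_contr[OF functional_counit] functional_left_contr[OF \<kappa>(1)])
      then show ?thesis using \<kappa>(3) that by (simp add: left_contr_counit)
    qed
    show "tensor2_eq scale (\<Delta> (?c j k)) (map (\<lambda>l. (?c j l, ?c l k)) bs)"
      if jk: "j \<in> B" "k \<in> B" for j k
    proof (rule tensor2_eqI)
      fix \<phi> \<psi> assume \<phi>: "functional scale \<phi>" and \<psi>: "functional scale \<psi>"
      have "(\<Sum>(a, b)\<leftarrow>\<Delta> (?c j k). \<phi> a * \<psi> b) =
          (\<Sum>(a, b)\<leftarrow>\<Delta> j. (\<Sum>(a\<^sub>1, a\<^sub>2)\<leftarrow>\<Delta> a. \<phi> a\<^sub>1 * \<psi> a\<^sub>2) * \<kappa> k b)"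
        by (rule functional_right_contr[OF functional_eval_comult[OF \<phi> \<psi>]])
      also have "\<dots> = (\<Sum>(a, b)\<leftarrow>\<Delta> j. \<phi> a * (\<Sum>(b\<^sub>1, b\<^sub>2)\<leftarrow>\<Delta> b. \<psi> b\<^sub>1 * \<kappa> k b\<^sub>2))"
        by (rule eval_coassoc_functional[OF \<phi> \<psi> \<kappa>(1)])
      also have "\<dots> = (\<Sum>l\<in>B. \<phi> (?c j l) * (\<Sum>(b\<^sub>1, b\<^sub>2)\<leftarrow>\<Delta> l. \<psi> b\<^sub>1 * \<kappa> k b\<^sub>2))"
        by (rule eval[OF jk(1) balanced_functional[OF \<phi> functional_eval_comult[OF \<psi> \<kappa>(1)]]])
      also have "\<dots> = (\<Sum>(a, b)\<leftarrow>map (\<lambda>l. (?c j l, ?c l k)) bs. \<phi> a * \<psi> b)"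
        using bs by (simp add: functional_right_contr[OF \<psi>] sum_list_distinct_conv_sum_set comp_def)
      finally show "(\<Sum>(a, b)\<leftarrow>\<Delta> (?c j k). \<phi> a * \<psi> b) = \<dots>" .
    qed
  qed
qed

end

section \<open>Cores and their dimensions in powers\<close>

text \<open>The set \<open>T\<close> of tests is a parameter, so that the same notion applies to
  \<open>E\<close> and, with composed maps, to its powers.\<close>

definition core :: "('a \<Rightarrow> 'b) set \<Rightarrow> 'a set \<Rightarrow> 'b set \<Rightarrow> 'a set"
  where "core T E P = {e \<in> E. \<forall>t\<in>T. t e \<in> P}"

lemma linear_comp_power:
  assumes "Vector_Spaces.linear s1 s2 t"
  shows "Vector_Spaces.linear (power_scale s1) (power_scale s2) ((\<circ>) t)"
  using assms by (auto simp: Vector_Spaces.linear_iff vector_space_power_scale fun_eq_iff)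

context vector_space_pair
begin

lemma subspace_core:
  assumes "vs1.subspace E" "vs2.subspace P" and T: "\<And>t. t \<in> T \<Longrightarrow> Vector_Spaces.linear s1 s2 t"
  shows "vs1.subspace (core T E P)"
proof (rule vs1.subspaceI)
  show "0 \<in> core T E P"
    using assms vs1.subspace_0 vs2.subspace_0 by (auto simp: core_def linear_0[OF T])
  show "x + y \<in> core T E P" if "x \<in> core T E P" "y \<in> core T E P" for x y
    using that assms vs1.subspace_add vs2.subspace_add by (auto simp: core_def linear_add[OF T])
  show "s1 c x \<in> core T E P" if "x \<in> core T E P" for c x
    using that assms vs1.subspace_scale vs2.subspace_scale by (auto simp: core_def linear_scale[OF T])
qed

lemma fin_dim_core:
  assumes "fin_dim_subspace s1 E" "vs2.subspace P" "\<And>t. t \<in> T \<Longrightarrow> Vector_Spaces.linear s1 s2 t"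
  shows "fin_dim_subspace s1 (core T E P)"
  by (rule vs1.fin_dim_subset[OF assms(1) subspace_core])
    (use assms vs1.fin_dim_subspaceD in \<open>auto simp: core_def\<close>)

text \<open>Induction on \<open>J\<close>: split \<open>U\<close> by the projection to one coordinate.\<close>

lemma dim_core_power_bound:
  assumes E: "fin_dim_subspace s1 E"
    and T: "\<And>t. t \<in> T \<Longrightarrow> Vector_Spaces.linear s1 s2 t"
    and L: "\<And>l. l \<in> L \<Longrightarrow> Vector_Spaces.linear s2 s2 l"
    and bound: "\<And>P. fin_dim_subspace s2 P \<Longrightarrow> \<forall>l\<in>L. l ` P \<subseteq> P \<Longrightarrow>
      a * vs1.dim (core T E P) \<le> b * vs2.dim P + m"
    and "finite J" "fin_dim_subspace (power_scale s2) U" "U \<subseteq> power_space J UNIV"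
    and "\<forall>l\<in>L. \<forall>z\<in>U. l \<circ> z \<in> U"
  shows "a * vector_space.dim (power_scale s1) (core ((\<circ>) ` T) (power_space J E) U) \<le>
    b * vector_space.dim (power_scale s2) U + card J * m"
  using assms(5-)
proof (induction J arbitrary: U)
  interpret p1: vector_space "power_scale s1" by (rule vector_space_power_scale) unfold_locales
  case empty
  have "core ((\<circ>) ` T) (power_space {} E) U \<subseteq> {0}"
    unfolding core_def power_space_empty by blast
  from p1.dim_subset_fin_dim[OF p1.fin_dim_zero this]
  have "p1.dim (core ((\<circ>) ` T) (power_space {} E) U) = 0"
    unfolding p1.dim_zero_subspace by simp
  then show ?case by (simp only: mult_0_right zero_le)
next
  interpret p1: vector_space "power_scale s1" by (rule vector_space_power_scale) unfold_locales
  interpret p2: vector_space "power_scale s2" by (rule vector_space_power_scale) unfold_locales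
  interpret pp: vector_space_pair "power_scale s1" "power_scale s2" ..
  interpret pr1: vector_space_pair "power_scale s1" s1 ..
  interpret pr2: vector_space_pair "power_scale s2" s2 ..
  case (insert j J)
  let ?\<pi> = "\<lambda>z. z j"
  let ?U' = "{z\<in>U. z j = 0}" and ?P = "(\<lambda>z. z j) ` U"
  let ?C = "core ((\<circ>) ` T) (power_space (insert j J) E) U"
  note proj1 = linear_power_component[OF vs1.vector_space_axioms, of j]
  note proj2 = linear_power_component[OF vs2.vector_space_axioms, of j]
  have subU: "p2.subspace U" using insert.prems(1) by (rule p2.fin_dim_subspaceD)
  have T': "\<And>t. t \<in> (\<circ>) ` T \<Longrightarrow> Vector_Spaces.linear (power_scale s1) (power_scale s2) t"
    using linear_comp_power[OF T] by blast
  have "p2.subspace ?U'"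
    using p2.subspace_inter[OF subU pr2.linear_subspace_kernel[OF proj2]] by (simp add: Int_def)
  then have U': "fin_dim_subspace (power_scale s2) ?U'"
    by (rule p2.fin_dim_subset[OF insert.prems(1)]) auto
  have E0: "0 \<in> E" using vs1.subspace_0[OF vs1.fin_dim_subspaceD[OF E]] .
  have fdE: "fin_dim_subspace (power_scale s1) (power_space J E)" if "finite J" for J
    by (rule fin_dim_dim_power_space(1)[OF vs1.vector_space_axioms E that])
  have C: "fin_dim_subspace (power_scale s1) ?C"
    by (rule pp.fin_dim_core[OF fdE subU T']) (use insert.hyps in auto)
  have C': "fin_dim_subspace (power_scale s1) (core ((\<circ>) ` T) (power_space J E) ?U')"
    by (rule pp.fin_dim_core[OF fdE p2.fin_dim_subspaceD[OF U'] T']) (use insert.hyps in auto)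
  have P: "fin_dim_subspace s2 ?P" by (rule pr2.fin_dim_image[OF proj2 insert.prems(1)])
  have CP: "fin_dim_subspace s1 (core T E ?P)"
    by (rule fin_dim_core[OF E vs2.fin_dim_subspaceD[OF P] T])
  \<comment> \<open>The coordinate \<open>j\<close> is restricted to the core: its kernel is handled
    by the induction hypothesis, its image by the given bound for the image \<open>?P\<close> of
    \<open>U\<close>.\<close>
  have "{z\<in>?C. z j = 0} \<subseteq> core ((\<circ>) ` T) (power_space J E) ?U'"
    using power_space_insert_kernel[OF insert.hyps(2) E0] linear_0[OF T] by (auto simp: core_def)
  then have 1: "p1.dim {z\<in>?C. z j = 0} \<le> p1.dim (core ((\<circ>) ` T) (power_space J E) ?U')"
    by (rule p1.dim_subset_fin_dim[OF C'])
  have "?\<pi> ` ?C \<subseteq> core T E ?P"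
  proof
    fix y assume "y \<in> ?\<pi> ` ?C"
    then obtain z where z: "z \<in> ?C" "y = z j" by blast
    have "t y \<in> ?P" if "t \<in> T" for t
      using z that by (intro image_eqI[of _ _ "t \<circ> z"]) (auto simp: core_def)
    then show "y \<in> core T E ?P"
      using z by (auto simp: core_def power_space_def)
  qed
  then have 2: "vs1.dim (?\<pi> ` ?C) \<le> vs1.dim (core T E ?P)"
    by (rule vs1.dim_subset_fin_dim[OF CP])
  have 3: "a * p1.dim (core ((\<circ>) ` T) (power_space J E) ?U') \<le> b * p2.dim ?U' + card J * m"
  proof (rule insert.IH[OF U'])
    show "?U' \<subseteq> power_space J UNIV"
      using insert.prems(2) by (auto simp: power_space_def)
    show "\<forall>l\<in>L. \<forall>z\<in>?U'. l \<circ> z \<in> ?U'"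
    proof (intro ballI)
      fix l z assume l: "l \<in> L" and z: "z \<in> ?U'"
      have "l 0 = 0"
        by (rule additive_zero) (use L[OF l] in \<open>simp add: Vector_Spaces.linear_iff\<close>)
      moreover have "l \<circ> z \<in> U" using insert.prems(3) l z by blast
      ultimately show "l \<circ> z \<in> ?U'" using z by simp
    qed
  qed
  have "\<forall>l\<in>L. l ` ?P \<subseteq> ?P"
  proof (intro ballI subsetI)
    fix l y assume l: "l \<in> L" and "y \<in> l ` ?P"
    then obtain z where "z \<in> U" "y = (l \<circ> z) j" by auto
    then show "y \<in> ?P" using insert.prems(3) l by blast
  qed
  then have 4: "a * vs1.dim (core T E ?P) \<le> b * vs2.dim ?P + m" by (rule bound[OF P])
  have 5: "vs2.dim ?P + p2.dim ?U' = p2.dim U" by (rule pr2.rank_nullity[OF proj2 insert.prems(1)])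
  have "a * p1.dim ?C = a * vs1.dim (?\<pi> ` ?C) + a * p1.dim {z\<in>?C. z j = 0}"
    by (simp only: pr1.rank_nullity[OF proj1 C, symmetric] distrib_left)
  also have "\<dots> \<le> a * vs1.dim (core T E ?P) + a * p1.dim (core ((\<circ>) ` T) (power_space J E) ?U')"
    using 1 2 by (intro add_mono mult_le_mono2)
  also have "\<dots> \<le> b * vs2.dim ?P + m + (b * p2.dim ?U' + card J * m)"
    using 3 4 by linarith
  also have "\<dots> = b * p2.dim U + card (insert j J) * m"
    using insert.hyps by (simp add: 5[symmetric] algebra_simps)
  finally show ?case .
qed

end

text \<open>The value \<open>a * dim (core T E P) - b * dim P\<close> is bounded by
  \<open>a * dim E\<close>, and \<open>P = {0}\<close> makes it nonnegative; hence the maximum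
  exists and is a natural number \<open>m\<close>.\<close>

lemma core_maximizer:
  assumes pair: "vector_space_pair s1 s2" and E: "fin_dim_subspace s1 E" and zero: "\<forall>l\<in>L. l 0 = 0"
  obtains P m where "fin_dim_subspace s2 P" "\<forall>l\<in>L. l ` P \<subseteq> P"
    "a * vector_space.dim s1 (core T E P) = b * vector_space.dim s2 P + m"
    "\<And>P'. fin_dim_subspace s2 P' \<Longrightarrow> \<forall>l\<in>L. l ` P' \<subseteq> P' \<Longrightarrow>
      a * vector_space.dim s1 (core T E P') \<le> b * vector_space.dim s2 P' + m"
proof -
  interpret vector_space_pair s1 s2 by fact
  let ?ok = "\<lambda>P. fin_dim_subspace s2 P \<and> (\<forall>l\<in>L. l ` P \<subseteq> P)"
  let ?Q = "\<lambda>m. \<exists>P. ?ok P \<and> a * vs1.dim (core T E P) = b * vs2.dim P + m"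
  have le: "vs1.dim (core T E P) \<le> vs1.dim E" for P
    by (rule vs1.dim_subset_fin_dim[OF E]) (auto simp: core_def)
  have "?ok {0}" using zero vs2.fin_dim_zero by auto
  then have "?Q (a * vs1.dim (core T E {0}))" using vs2.dim_zero_subspace by (intro exI[of _ "{0}"]) simp
  moreover have bound: "m \<le> a * vs1.dim E" if "?Q m" for m
    using that le by (metis le_add2 mult_le_mono2 order_trans)
  ultimately have Q: "?Q (GREATEST m. ?Q m)"
    by (rule GreatestI_nat[where P = ?Q])
  then obtain P where P: "?ok P" "a * vs1.dim (core T E P) = b * vs2.dim P + (GREATEST m. ?Q m)" by blast
  show ?thesis
  proof (rule that)
    fix P' assume P': "fin_dim_subspace s2 P'" "\<forall>l\<in>L. l ` P' \<subseteq> P'"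
    show "a * vs1.dim (core T E P') \<le> b * vs2.dim P' + (GREATEST m. ?Q m)"
    \<comment> \<open>A negative value would be truncated in \<open>nat\<close>; the bound is then
      trivial.\<close>
    proof (cases "a * vs1.dim (core T E P') \<le> b * vs2.dim P'")
      case False
      then have "?Q (a * vs1.dim (core T E P') - b * vs2.dim P')"
        using P' by (intro exI[of _ P']) simp
      then have "a * vs1.dim (core T E P') - b * vs2.dim P' \<le> (GREATEST m. ?Q m)"
        by (rule Greatest_le_nat[where P = ?Q]) (rule bound)
      then show ?thesis by simp
    qed simp
  qed (use P in auto)
qed

section \<open>Matrix coefficients acting on powers\<close>

text \<open>On \<open>V \<otimes> M\<close>, with \<open>V\<close> the comodule whose coefficients
  are \<open>c\<close>, this is coaction followed by action: \<open>v\<^sub>j \<otimes> m\<close> is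
  sent to \<open>\<Sum>\<^sub>k v\<^sub>k \<otimes> c j k m\<close>.\<close>

definition matrix_action :: "('h \<Rightarrow> 'm \<Rightarrow> 'm) \<Rightarrow> 'j set \<Rightarrow> ('j \<Rightarrow> 'j \<Rightarrow> 'h) \<Rightarrow> ('j \<Rightarrow> 'm) \<Rightarrow> 'j \<Rightarrow> 'm::ab_group_add"
  where "matrix_action act B c z = (\<lambda>k. if k \<in> B then \<Sum>j\<in>B. act (c j k) (z j) else 0)"

lemma (in module_coalgebra) linear_matrix_action:
  "Vector_Spaces.linear (power_scale scaleM) (power_scale scaleM) (matrix_action act B c)"
  by (auto simp: Vector_Spaces.linear_iff vector_space_power_scale M.vector_space_axioms fun_eq_iff
      matrix_action_def act_add_right act_scale_right sum.distrib M.scale_sum_right)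

text \<open>
  Three instances are needed, with \<open>D \<phi> m\<close> in the notation of Sweedler: \<open>\<phi> (m\<^sub>1) q(m\<^sub>2)\<close> from
  \<open>M\<close> to \<open>Q\<close>, and \<open>\<phi> (y\<^sub>1) y\<^sub>2\<close> and \<open>\<phi> (y\<^sub>2) y\<^sub>1\<close> on \<open>Q\<close>.
\<close>

locale equivariant_contraction =
  H: hopf_algebra scaleH \<Delta>H \<epsilon>H S +
  M: module_coalgebra scaleH \<Delta>H \<epsilon>H scaleM \<Delta>M \<epsilon>M actM +
  Q: module_coalgebra scaleH \<Delta>H \<epsilon>H scaleQ \<Delta>Q \<epsilon>Q actQ
  for scaleH :: "'k::field \<Rightarrow> 'h::ring_1 \<Rightarrow> 'h" and \<Delta>H \<epsilon>H S
    and scaleM :: "'k \<Rightarrow> 'm::ab_group_add \<Rightarrow> 'm" and \<Delta>M \<epsilon>M actM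
    and scaleQ :: "'k \<Rightarrow> 'q::ab_group_add \<Rightarrow> 'q" and \<Delta>Q \<epsilon>Q actQ +
  fixes D :: "('m \<Rightarrow> 'k) \<Rightarrow> 'm \<Rightarrow> 'q"
  assumes cocommutative: "cocommutative scaleH \<Delta>H"
    and linear: "functional scaleM \<phi> \<Longrightarrow> Vector_Spaces.linear scaleM scaleQ (D \<phi>)"
    and add_functional: "D (\<lambda>x. \<phi> x + \<psi> x) m = D \<phi> m + D \<psi> m"
    and scale_functional: "D (\<lambda>x. c * \<phi> x) m = scaleQ c (D \<phi> m)"
    and contract_act: "functional scaleM \<phi> \<Longrightarrow>
      D \<phi> (actM h m) = (\<Sum>(h\<^sub>1, h\<^sub>2)\<leftarrow>\<Delta>H h. actQ h\<^sub>2 (D (\<lambda>x. \<phi> (actM h\<^sub>1 x)) m))"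
begin

lemma functional_act: "functional scaleM \<phi> \<Longrightarrow> functional scaleM (\<lambda>x. \<phi> (actM h x))"
  by (simp add: functional_def M.act_add_right M.act_scale_right)

lemma balanced_contraction:
  assumes "functional scaleM \<phi>"
  shows "balanced scaleH (\<lambda>h\<^sub>1 h\<^sub>2. actQ h\<^sub>2 (D (\<lambda>x. \<phi> (actM h\<^sub>1 x)) m))"
    and "balanced scaleH (\<lambda>h\<^sub>2 h\<^sub>1. actQ h\<^sub>2 (D (\<lambda>x. \<phi> (actM h\<^sub>1 x)) m))"
  by (simp_all add: balanced_def M.act_add_left M.act_scale_left functionalD[OF assms]
      add_functional scale_functional Q.act_add_left Q.act_add_right Q.act_scale_left Q.act_scale_right)

lemma zero_functional: "D (\<lambda>x. 0) m = 0"
  using add_functional[of "\<lambda>x. 0" "\<lambda>x. 0" m] by simp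

lemma sum_functional: "finite A \<Longrightarrow> D (\<lambda>x. \<Sum>i\<in>A. \<phi> i x) m = (\<Sum>i\<in>A. D (\<phi> i) m)"
  by (induction A rule: finite_induct) (simp_all add: zero_functional add_functional)

context
  fixes bs :: "'h list" and c :: "'h \<Rightarrow> 'h \<Rightarrow> 'h" and \<phi> :: "'m \<Rightarrow> 'k"
  assumes c: "H.coefficient_matrix bs c" and \<phi>: "functional scaleM \<phi>"
begin

text \<open>The first form follows the coproduct of \<open>c j k\<close>, the second exchanges its
  factors by cocommutativity. One moves contractions past the matrix action, the other lets the
  antipode cancel coefficients.\<close>

lemma contract_coefficient:
  assumes jk: "j \<in> set bs" "k \<in> set bs" and "functional scaleM \<psi>"
  shows "D \<psi> (actM (c j k) m) = (\<Sum>l\<in>set bs. actQ (c l k) (D (\<lambda>x. \<psi> (actM (c j l) x)) m))"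
    and "D \<psi> (actM (c j k) m) = (\<Sum>l\<in>set bs. actQ (c j l) (D (\<lambda>x. \<psi> (actM (c l k) x)) m))"
proof -
  have eq: "tensor2_eq scaleH (\<Delta>H (c j k)) (map (\<lambda>l. (c j l, c l k)) bs)" and bs: "distinct bs"
    using c jk by (auto simp: H.coefficient_matrix_def)
  note bal = balanced_contraction[OF assms(3), of m]
  show "D \<psi> (actM (c j k) m) = (\<Sum>l\<in>set bs. actQ (c l k) (D (\<lambda>x. \<psi> (actM (c j l) x)) m))"
    unfolding contract_act[OF assms(3)] tensor2_eq_eval[OF eq bal(1)]
    using bs by (simp add: sum_list_distinct_conv_sum_set comp_def)
  have "tensor2_eq scaleH (\<Delta>H (c j k)) [(b, a). (a, b) \<leftarrow> \<Delta>H (c j k)]"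
    using cocommutative by (simp add: cocommutative_def)
  from tensor2_eq_eval[OF this bal(1)]
  have "D \<psi> (actM (c j k) m) =
      (\<Sum>(h\<^sub>2, h\<^sub>1)\<leftarrow>\<Delta>H (c j k). actQ h\<^sub>2 (D (\<lambda>x. \<psi> (actM h\<^sub>1 x)) m))"
    unfolding contract_act[OF assms(3)] sum_list_prod_swap .
  then show "D \<psi> (actM (c j k) m) = (\<Sum>l\<in>set bs. actQ (c j l) (D (\<lambda>x. \<psi> (actM (c l k) x)) m))"
    unfolding tensor2_eq_eval[OF eq bal(2)]
    using bs by (simp add: sum_list_distinct_conv_sum_set comp_def)
qed

text \<open>Cocommutativity turns the axiom \<open>S(h\<^sub>1) h\<^sub>2 = \<epsilon>(h)\<close>
  into \<open>S(h\<^sub>2) h\<^sub>1 = \<epsilon>(h)\<close>, which is then evaluated on the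
  coproduct of \<open>c i k\<close>.\<close>

lemma antipode_coefficient:
  assumes ik: "i \<in> set bs" "k \<in> set bs"
  shows "(\<Sum>l\<in>set bs. S (c l k) * c i l) = (if i = k then 1 else 0)"
proof -
  have eq: "tensor2_eq scaleH (\<Delta>H (c i k)) (map (\<lambda>l. (c i l, c l k)) bs)" and bs: "distinct bs"
    and \<epsilon>: "\<epsilon>H (c i k) = (if i = k then 1 else 0)"
    using c ik by (auto simp: H.coefficient_matrix_def)
  have add: "S (x + y) = S x + S y" and sc: "S (scaleH a x) = scaleH a (S x)" for x y a
    using H.antipode_linear by (auto simp: Vector_Spaces.linear_iff)
  have bal: "balanced scaleH (\<lambda>a b. S a * b)" "balanced scaleH (\<lambda>a b. S b * a)"
    by (simp_all add: balanced_def add sc algebra_simps H.scale_mult_left H.scale_mult_right)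
  have "tensor2_eq scaleH (\<Delta>H (c i k)) [(b, a). (a, b) \<leftarrow> \<Delta>H (c i k)]"
    using cocommutative by (simp add: cocommutative_def)
  from tensor2_eq_eval[OF this bal(1)]
  have "scaleH (\<epsilon>H (c i k)) 1 = (\<Sum>(a, b)\<leftarrow>\<Delta>H (c i k). S b * a)"
    unfolding H.antipode_left sum_list_prod_swap .
  then show ?thesis
    unfolding tensor2_eq_eval[OF eq bal(2)] \<epsilon>
    using bs by (simp add: sum_list_distinct_conv_sum_set comp_def split: if_splits)
qed

text \<open>Needed to see that the matrix action carries powers of stable subspaces to stable
  subspaces: a contraction of an image is the image of a family of sums of contractions.\<close>

lemma contract_matrix_action:
  assumes k: "k \<in> set bs"
  shows "D \<phi> (matrix_action actM (set bs) c z k) =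
    matrix_action actQ (set bs) c (\<lambda>l. \<Sum>j\<in>set bs. D (\<lambda>x. \<phi> (actM (c j l) x)) (z j)) k"
proof -
  interpret l: Vector_Spaces.linear scaleM scaleQ "D \<phi>" by (rule linear[OF \<phi>])
  have "D \<phi> (matrix_action actM (set bs) c z k) =
      (\<Sum>j\<in>set bs. \<Sum>l\<in>set bs. actQ (c l k) (D (\<lambda>x. \<phi> (actM (c j l) x)) (z j)))"
    using k by (simp add: matrix_action_def l.sum contract_coefficient(1)[OF _ k \<phi>])
  also have "\<dots> = (\<Sum>l\<in>set bs. \<Sum>j\<in>set bs. actQ (c l k) (D (\<lambda>x. \<phi> (actM (c j l) x)) (z j)))"
    by (rule sum.swap)
  also have "\<dots> = (\<Sum>l\<in>set bs. actQ (c l k) (\<Sum>j\<in>set bs. D (\<lambda>x. \<phi> (actM (c j l) x)) (z j)))"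
    by (simp add: additive_sum[of "actQ _"] Q.act_add_right)
  finally show ?thesis using k by (simp add: matrix_action_def)
qed

text \<open>The reverse direction: through the antipode, the image of a contraction of
  \<open>z\<close> is expressed by contractions of the image of \<open>z\<close>. This takes the
  place of an explicit inverse of the matrix action.\<close>

lemma matrix_action_contract:
  assumes k: "k \<in> set bs"
  shows "matrix_action actQ (set bs) c (D \<phi> \<circ> z) k =
    (\<Sum>l\<in>set bs. D (\<lambda>x. \<phi> (actM (S (c l k)) x)) (matrix_action actM (set bs) c z l))"
proof -
  let ?\<phi> = "\<lambda>h x. \<phi> (actM h x)"
  have "D (?\<phi> (S (c l k))) (matrix_action actM (set bs) c z l) =
      (\<Sum>j\<in>set bs. \<Sum>i\<in>set bs. actQ (c j i) (D (?\<phi> (S (c l k) * c i l)) (z j)))"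
    if l: "l \<in> set bs" for l
  proof -
    interpret l: Vector_Spaces.linear scaleM scaleQ "D (?\<phi> (S (c l k)))"
      by (rule linear[OF functional_act[OF \<phi>]])
    show ?thesis
      using l by (simp add: matrix_action_def l.sum contract_coefficient(2)[OF _ l functional_act[OF \<phi>]]
          M.act_mult)
  qed
  then have "(\<Sum>l\<in>set bs. D (?\<phi> (S (c l k))) (matrix_action actM (set bs) c z l)) =
      (\<Sum>l\<in>set bs. \<Sum>j\<in>set bs. \<Sum>i\<in>set bs. actQ (c j i) (D (?\<phi> (S (c l k) * c i l)) (z j)))"
    by simp
  also have "\<dots> = (\<Sum>j\<in>set bs. \<Sum>l\<in>set bs. \<Sum>i\<in>set bs. actQ (c j i) (D (?\<phi> (S (c l k) * c i l)) (z j)))"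
    by (rule sum.swap)
  also have "\<dots> = (\<Sum>j\<in>set bs. \<Sum>i\<in>set bs. \<Sum>l\<in>set bs. actQ (c j i) (D (?\<phi> (S (c l k) * c i l)) (z j)))"
    by (rule sum.cong[OF HOL.refl]) (rule sum.swap)
  \<comment> \<open>With the sum over \<open>l\<close> innermost, the antipode relation leaves only
    \<open>i = k\<close>.\<close>
  also have "\<dots> = (\<Sum>j\<in>set bs. \<Sum>i\<in>set bs. actQ (c j i) (if i = k then D \<phi> (z j) else 0))"
  proof (intro sum.cong HOL.refl)
    fix j i assume i: "i \<in> set bs"
    have "(\<Sum>l\<in>set bs. D (?\<phi> (S (c l k) * c i l)) (z j)) = D (\<lambda>x. \<Sum>l\<in>set bs. ?\<phi> (S (c l k) * c i l) x) (z j)"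
      by (simp add: sum_functional)
    also have "(\<lambda>x. \<Sum>l\<in>set bs. ?\<phi> (S (c l k) * c i l) x) = ?\<phi> (if i = k then 1 else 0)"
      unfolding antipode_coefficient[OF i k, symmetric]
      by (simp add: functional_sum[OF \<phi>] additive_sum[of "\<lambda>h. actM h _"] M.act_add_left)
    also have "D (?\<phi> (if i = k then 1 else 0)) (z j) = (if i = k then D \<phi> (z j) else 0)"
    proof -
      have "actM 0 x = 0" for x using M.act_add_left[of 0 0 x] by simp
      moreover have "\<phi> 0 = 0" by (rule functional_zero[OF \<phi>])
      ultimately show ?thesis by (simp add: M.act_one zero_functional)
    qed
    finally show "(\<Sum>l\<in>set bs. actQ (c j i) (D (?\<phi> (S (c l k) * c i l)) (z j))) =
        actQ (c j i) (if i = k then D \<phi> (z j) else 0)"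
      by (simp add: additive_sum[of "actQ _", symmetric] Q.act_add_right)
  qed
  also have "\<dots> = (\<Sum>j\<in>set bs. actQ (c j k) (D \<phi> (z j)))"
  proof (intro sum.cong HOL.refl)
    fix j
    have "actQ h 0 = 0" for h using Q.act_add_right[of h 0 0] by simp
    then have "(\<Sum>i\<in>set bs. actQ (c j i) (if i = k then D \<phi> (z j) else 0)) =
        (\<Sum>i\<in>set bs. if i = k then actQ (c j i) (D \<phi> (z j)) else 0)"
      by (intro sum.cong) auto
    then show "(\<Sum>i\<in>set bs. actQ (c j i) (if i = k then D \<phi> (z j) else 0)) = actQ (c j k) (D \<phi> (z j))"
      using k by simp
  qed
  finally show ?thesis using k by (simp add: matrix_action_def)
qed

lemma contract_matrix_action_in:
  assumes P': "Q.M.subspace P'" and in_P': "\<And>\<psi> x. functional scaleM \<psi> \<Longrightarrow> x \<in> P \<Longrightarrow> D \<psi> x \<in> P'"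
    and z: "z \<in> power_space (set bs) P"
  shows "D \<phi> \<circ> matrix_action actM (set bs) c z \<in> matrix_action actQ (set bs) c ` power_space (set bs) P'"
proof -
  interpret l: Vector_Spaces.linear scaleM scaleQ "D \<phi>" by (rule linear[OF \<phi>])
  let ?w = "\<lambda>l. if l \<in> set bs then \<Sum>j\<in>set bs. D (\<lambda>x. \<phi> (actM (c j l) x)) (z j) else 0"
  have "(\<Sum>j\<in>set bs. D (\<lambda>x. \<phi> (actM (c j l) x)) (z j)) \<in> P'" for l
    using z in_P'[OF functional_act[OF \<phi>]]
    by (intro Q.M.subspace_sum[OF P']) (auto simp: power_space_def)
  then have w: "?w \<in> power_space (set bs) P'" by (auto simp: power_space_def)
  have eq: "D \<phi> \<circ> matrix_action actM (set bs) c z = matrix_action actQ (set bs) c ?w"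
  proof
    fix k
    show "(D \<phi> \<circ> matrix_action actM (set bs) c z) k = matrix_action actQ (set bs) c ?w k"
    proof (cases "k \<in> set bs")
      case True
      then show ?thesis
        using contract_matrix_action[OF True, of z] by (simp add: matrix_action_def)
    qed (simp add: matrix_action_def)
  qed
  show ?thesis unfolding eq by (rule imageI[OF w])
qed

text \<open>Makes preimages under the matrix action stable, as
  \<open>contract_matrix_action_in\<close> does for images.\<close>

lemma matrix_action_contract_in:
  assumes R: "Q.M.subspace R"
    and in_R: "\<And>\<psi> k. functional scaleM \<psi> \<Longrightarrow> k \<in> set bs \<Longrightarrow>
      D \<psi> (matrix_action actM (set bs) c z k) \<in> R"
  shows "matrix_action actQ (set bs) c (D \<phi> \<circ> z) \<in> power_space (set bs) R"
proof -
  have "matrix_action actQ (set bs) c (D \<phi> \<circ> z) k \<in> R" if "k \<in> set bs" for k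
    unfolding matrix_action_contract[OF that]
    using in_R[OF functional_act[OF \<phi>]] by (intro Q.M.subspace_sum[OF R])
  moreover have "matrix_action actQ (set bs) c (D \<phi> \<circ> z) k = 0" if "k \<notin> set bs" for k
    using that by (simp add: matrix_action_def)
  ultimately show ?thesis by (simp add: power_space_def)
qed

end

end

section \<open>Optimal subcoalgebras\<close>

lemma functional_linear_comp:
  "functional s2 \<psi> \<Longrightarrow> Vector_Spaces.linear s1 s2 f \<Longrightarrow> functional s1 (\<lambda>x. \<psi> (f x))"
  by (simp add: functional_def Vector_Spaces.linear_iff)

lemma linear_sum_list:
  assumes "Vector_Spaces.linear s1 s2 f"
  shows "f (sum_list (map g xs)) = (\<Sum>x\<leftarrow>xs. f (g x))"
  by (rule additive_sum_list) (use assms in \<open>simp add: Vector_Spaces.linear_iff\<close>)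

lemma cocommutative_eval_swap:
  assumes "cocommutative s \<Delta>" "balanced s \<beta>"
  shows "(\<Sum>(a, b)\<leftarrow>\<Delta> x. \<beta> a b) = (\<Sum>(a, b)\<leftarrow>\<Delta> x. \<beta> b a)"
proof -
  have "tensor2_eq s (\<Delta> x) [(b, a). (a, b) \<leftarrow> \<Delta> x]" using assms(1) by (simp add: cocommutative_def)
  from tensor2_eq_eval[OF this assms(2)] show ?thesis unfolding sum_list_prod_swap .
qed

section \<open>Compatibility of the contractions with the action\<close>

context module_coalgebra
begin

lemma left_contr_act:
  assumes "functional scaleM \<phi>"
  shows "M.left_contr \<phi> (act h m) =
    (\<Sum>(h\<^sub>1, h\<^sub>2)\<leftarrow>\<Delta>H h. act h\<^sub>2 (M.left_contr (\<lambda>x. \<phi> (act h\<^sub>1 x)) m))"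
  unfolding M.left_contr_def tensor2_eq_eval[OF comult_act M.balanced_left_contr[OF assms]]
  by (simp add: case_prod_unfold sum_list_map_concat comp_def additive_sum_list[of "act _"]
      act_add_right act_scale_right)

lemma right_contr_act:
  assumes "functional scaleM \<phi>"
  shows "M.right_contr \<phi> (act h m) =
    (\<Sum>(h\<^sub>1, h\<^sub>2)\<leftarrow>\<Delta>H h. act h\<^sub>1 (M.right_contr (\<lambda>x. \<phi> (act h\<^sub>2 x)) m))"
  unfolding M.right_contr_def tensor2_eq_eval[OF comult_act M.balanced_right_contr[OF assms]]
  by (simp add: case_prod_unfold sum_list_map_concat comp_def additive_sum_list[of "act _"]
      act_add_right act_scale_right)

end

context coalgebra
begin

lemma left_contr_add_functional: "left_contr (\<lambda>x. \<phi> x + \<psi> x) m = left_contr \<phi> m + left_contr \<psi> m"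
  by (simp add: left_contr_def case_prod_unfold scale_left_distrib sum_list_addf)

lemma left_contr_scale_functional: "left_contr (\<lambda>x. c * \<phi> x) m = scale c (left_contr \<phi> m)"
  by (simp add: left_contr_def case_prod_unfold scale_sum_list)

lemma right_contr_add_functional: "right_contr (\<lambda>x. \<phi> x + \<psi> x) m = right_contr \<phi> m + right_contr \<psi> m"
  by (simp add: right_contr_def case_prod_unfold scale_left_distrib sum_list_addf)

lemma right_contr_scale_functional: "right_contr (\<lambda>x. c * \<phi> x) m = scale c (right_contr \<phi> m)"
  by (simp add: right_contr_def case_prod_unfold scale_sum_list)

end

text \<open>Here \<open>n\<close> is the size of the matrix; \<open>p\<close>, \<open>r\<close> and
  \<open>e\<close>, \<open>f\<close> are the dimensions of two optimal subspaces and of their cores;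
  \<open>u\<close>, \<open>x\<close> are those of the preimages over \<open>Q\<close> and
  \<open>M\<close>, and \<open>s\<close>, \<open>y\<close> those of the sums. Adding the two bounds
  and cancelling gives \<open>(b - b') * (n * p - u) \<le> 0\<close> over the integers.\<close>

lemma optimal_dim_arith:
  fixes a b b' m m' n p r e f x y u s :: nat
  assumes 1: "a * x \<le> b * u + n * m" and 2: "a * y \<le> b' * s + n * m'"
    and 3: "s + u = dr + dp" and 4: "y + x = df + de"
    and 5: "a * e = b * p + m" and 6: "a * f = b' * r + m'" and less: "b' < b"
    and "dp = n * p" "dr = n * r" "de = n * e" "df = n * f"
  shows "n * p \<le> u"
proof -
  note eqs = assms(8-11)
  have "n * (b * p + m) + n * (b' * r + m') = a * y + a * x"
    using 4 unfolding eqs 5[symmetric] 6[symmetric] by (metis distrib_left mult.left_commute add.commute)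
  also have "\<dots> \<le> b * u + n * m + (b' * s + n * m')" using 1 2 by linarith
  finally have "b * (n * p) + b' * (n * r) \<le> b * u + b' * s" by (simp add: algebra_simps)
  moreover have "b' * s + b' * u = b' * (n * r) + b' * (n * p)"
    using 3 unfolding eqs by (metis distrib_left)
  moreover obtain w where w: "b = b' + w" "0 < w" using less by (metis less_imp_add_positive)
  ultimately have "w * (n * p) \<le> w * u" unfolding w(1) distrib_right by linarith
  then show ?thesis using w(2) by simp
qed

locale module_coalgebra_morphism =
  H: hopf_algebra scaleH \<Delta>H \<epsilon>H S +
  M: module_coalgebra scaleH \<Delta>H \<epsilon>H scaleM \<Delta>M \<epsilon>M actM +
  Q: module_coalgebra scaleH \<Delta>H \<epsilon>H scaleQ \<Delta>Q \<epsilon>Q actQ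
  for scaleH :: "'k::field \<Rightarrow> 'h::ring_1 \<Rightarrow> 'h" and \<Delta>H \<epsilon>H S
    and scaleM :: "'k \<Rightarrow> 'm::ab_group_add \<Rightarrow> 'm" and \<Delta>M \<epsilon>M actM
    and scaleQ :: "'k \<Rightarrow> 'q::ab_group_add \<Rightarrow> 'q" and \<Delta>Q \<epsilon>Q actQ +
  fixes q :: "'m \<Rightarrow> 'q"
  assumes cocommutative: "cocommutative scaleH \<Delta>H"
    and morphism: "coalgebra_morphism scaleM \<Delta>M \<epsilon>M scaleQ \<Delta>Q \<epsilon>Q q"
    and q_act: "q (actM h m) = actQ h (q m)"
begin

lemma linear_q: "Vector_Spaces.linear scaleM scaleQ q"
  using morphism by (simp add: coalgebra_morphism_def)

sublocale pair: vector_space_pair scaleM scaleQ ..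

sublocale T: equivariant_contraction scaleH \<Delta>H \<epsilon>H S scaleM \<Delta>M \<epsilon>M actM scaleQ \<Delta>Q \<epsilon>Q actQ
  "\<lambda>\<phi> m. q (M.M.left_contr \<phi> m)"
proof (rule equivariant_contraction.intro[OF H.hopf_algebra_axioms M.module_coalgebra_axioms
      Q.module_coalgebra_axioms], rule equivariant_contraction_axioms.intro)
  show "cocommutative scaleH \<Delta>H" by (rule cocommutative)
  fix \<phi> assume \<phi>: "functional scaleM \<phi>"
  show "Vector_Spaces.linear scaleM scaleQ (\<lambda>m. q (M.M.left_contr \<phi> m))"
    using Vector_Spaces.linear_compose[OF M.M.linear_left_contr[OF \<phi>] linear_q] by (simp add: comp_def)
  show "q (M.M.left_contr \<phi> (actM h m)) =
      (\<Sum>(h\<^sub>1, h\<^sub>2)\<leftarrow>\<Delta>H h. actQ h\<^sub>2 (q (M.M.left_contr (\<lambda>x. \<phi> (actM h\<^sub>1 x)) m)))" for h m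
    unfolding M.left_contr_act[OF \<phi>]
    by (simp add: case_prod_unfold linear_sum_list[OF linear_q] q_act)
qed (simp_all only: M.M.left_contr_add_functional M.M.left_contr_scale_functional
    pair.linear_add[OF linear_q] pair.linear_scale[OF linear_q])

sublocale L: equivariant_contraction scaleH \<Delta>H \<epsilon>H S scaleQ \<Delta>Q \<epsilon>Q actQ scaleQ \<Delta>Q \<epsilon>Q actQ
  Q.M.left_contr
proof (rule equivariant_contraction.intro[OF H.hopf_algebra_axioms Q.module_coalgebra_axioms
      Q.module_coalgebra_axioms], rule equivariant_contraction_axioms.intro)
  show "cocommutative scaleH \<Delta>H" by (rule cocommutative)
  fix \<phi> assume \<phi>: "functional scaleQ \<phi>"
  show "Vector_Spaces.linear scaleQ scaleQ (Q.M.left_contr \<phi>)" by (rule Q.M.linear_left_contr[OF \<phi>])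
  show "Q.M.left_contr \<phi> (actQ h m) =
      (\<Sum>(h\<^sub>1, h\<^sub>2)\<leftarrow>\<Delta>H h. actQ h\<^sub>2 (Q.M.left_contr (\<lambda>x. \<phi> (actQ h\<^sub>1 x)) m))" for h m
    by (rule Q.left_contr_act[OF \<phi>])
qed (rule Q.M.left_contr_add_functional Q.M.left_contr_scale_functional)+

sublocale R: equivariant_contraction scaleH \<Delta>H \<epsilon>H S scaleQ \<Delta>Q \<epsilon>Q actQ scaleQ \<Delta>Q \<epsilon>Q actQ
  Q.M.right_contr
proof (rule equivariant_contraction.intro[OF H.hopf_algebra_axioms Q.module_coalgebra_axioms
      Q.module_coalgebra_axioms], rule equivariant_contraction_axioms.intro)
  show "cocommutative scaleH \<Delta>H" by (rule cocommutative)
  fix \<phi> assume \<phi>: "functional scaleQ \<phi>"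
  show "Vector_Spaces.linear scaleQ scaleQ (Q.M.right_contr \<phi>)" by (rule Q.M.linear_right_contr[OF \<phi>])
  \<comment> \<open>A right contraction leaves \<open>h\<^sub>1\<close> outside; cocommutativity
    gives the form with \<open>h\<^sub>2\<close> outside that the locale asks for.\<close>
  have "balanced scaleH (\<lambda>h\<^sub>1 h\<^sub>2. actQ h\<^sub>1 (Q.M.right_contr (\<lambda>x. \<phi> (actQ h\<^sub>2 x)) m))" for m
    by (simp add: balanced_def Q.act_add_left Q.act_scale_left Q.act_add_right Q.act_scale_right
        functionalD[OF \<phi>] Q.M.right_contr_add_functional Q.M.right_contr_scale_functional)
  then show "Q.M.right_contr \<phi> (actQ h m) =
      (\<Sum>(h\<^sub>1, h\<^sub>2)\<leftarrow>\<Delta>H h. actQ h\<^sub>2 (Q.M.right_contr (\<lambda>x. \<phi> (actQ h\<^sub>1 x)) m))" for h m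
    unfolding Q.right_contr_act[OF \<phi>] by (rule cocommutative_eval_swap[OF cocommutative])
qed (rule Q.M.right_contr_add_functional Q.M.right_contr_scale_functional)+

text \<open>
  A tensor lies in \<open>M \<otimes> P\<close> iff all its contractions by functionals on \<open>M\<close> lie in \<open>P\<close>, so that
  \<open>core coactions E P\<close> is \<open>E\<^sub>P\<close>; likewise a finite-dimensional subspace of \<open>Q\<close> is a subcoalgebra
  iff it is stable under \<open>contractions\<close>.
\<close>

definition coactions :: "('m \<Rightarrow> 'q) set"
  where "coactions = {\<lambda>m. q (M.M.left_contr \<phi> m) |\<phi>. functional scaleM \<phi>}"

definition contractions :: "('q \<Rightarrow> 'q) set"
  where "contractions = {Q.M.left_contr \<phi> |\<phi>. functional scaleQ \<phi>} \<union>
    {Q.M.right_contr \<phi> |\<phi>. functional scaleQ \<phi>}"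

lemma linear_coactions: "t \<in> coactions \<Longrightarrow> Vector_Spaces.linear scaleM scaleQ t"
  unfolding coactions_def using T.linear by blast

lemma linear_contractions: "l \<in> contractions \<Longrightarrow> Vector_Spaces.linear scaleQ scaleQ l"
  unfolding contractions_def using L.linear R.linear by blast

lemma subcoalgebra_contractions:
  assumes "fin_dim_subspace scaleQ P" "\<forall>l\<in>contractions. l ` P \<subseteq> P"
  shows "subcoalgebra scaleQ \<Delta>Q P"
  using assms(2) by (intro Q.M.subcoalgebraI[OF assms(1)]) (auto simp: contractions_def)

text \<open>Contracting \<open>q e\<close> by \<open>\<phi>\<close> is \<open>q\<close> applied to
  the contraction of \<open>e\<close> by the pullback \<open>\<phi> \<circ> q\<close>, which stays
  in \<open>E\<close>.\<close>

lemma contractions_image: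
  assumes E: "subcoalgebra scaleM \<Delta>M E"
  shows "\<forall>l\<in>contractions. l ` q ` E \<subseteq> q ` E"
proof (intro ballI subsetI)
  fix l y assume l: "l \<in> contractions" and "y \<in> l ` q ` E"
  then obtain e where e: "e \<in> E" and y: "y = l (q e)" by blast
  have eq: "tensor2_eq scaleQ (\<Delta>Q (q e)) [(q a, q b). (a, b) \<leftarrow> \<Delta>M e]"
    using morphism by (simp add: coalgebra_morphism_def)
  have "\<exists>\<phi>. functional scaleQ \<phi> \<and> (l = Q.M.left_contr \<phi> \<or> l = Q.M.right_contr \<phi>)"
    using l by (auto simp: contractions_def)
  then obtain \<phi> where \<phi>: "functional scaleQ \<phi>" "l = Q.M.left_contr \<phi> \<or> l = Q.M.right_contr \<phi>"
    by blast
  note \<phi>q = functional_linear_comp[OF \<phi>(1) linear_q]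
  have "Q.M.left_contr \<phi> (q e) = q (M.M.left_contr (\<lambda>x. \<phi> (q x)) e)"
    unfolding Q.M.left_contr_def M.M.left_contr_def
      tensor2_eq_eval[OF eq Q.M.balanced_left_contr[OF \<phi>(1)]]
    by (simp add: case_prod_unfold sum_list_map_concat comp_def linear_sum_list[OF linear_q]
        pair.linear_scale[OF linear_q])
  moreover have "Q.M.right_contr \<phi> (q e) = q (M.M.right_contr (\<lambda>x. \<phi> (q x)) e)"
    unfolding Q.M.right_contr_def M.M.right_contr_def
      tensor2_eq_eval[OF eq Q.M.balanced_right_contr[OF \<phi>(1)]]
    by (simp add: case_prod_unfold sum_list_map_concat comp_def linear_sum_list[OF linear_q]
        pair.linear_scale[OF linear_q])
  ultimately show "y \<in> q ` E"
    using \<phi>(2) y M.M.subcoalgebra_left_contr[OF E \<phi>q e] M.M.subcoalgebra_right_contr[OF E \<phi>q e]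
    by auto
qed

lemma core_image:
  assumes E: "subcoalgebra scaleM \<Delta>M E"
  shows "core coactions E (q ` E) = E"
  using M.M.subcoalgebra_left_contr[OF E] by (auto simp: core_def coactions_def)

text \<open>Applying the counit of \<open>Q\<close> to the coaction returns the element itself,
  because \<open>q\<close> preserves counits; so only 0 has zero coaction.\<close>

lemma core_zero:
  assumes "0 \<in> E" shows "core coactions E {0} = {0}"
proof -
  have "x = 0" if x: "x \<in> core coactions E {0}" for x
  proof (rule M.M.functional_separates)
    fix \<phi> assume \<phi>: "functional scaleM \<phi>"
    have "q (M.M.left_contr \<phi> x) = 0" using x \<phi> by (auto simp: core_def coactions_def)
    moreover have "\<epsilon>Q (q m) = \<epsilon>M m" for m using morphism by (simp add: coalgebra_morphism_def)
    ultimately have "\<epsilon>M (M.M.left_contr \<phi> x) = 0"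
      using functional_zero[OF Q.M.functional_counit] by metis
    then have "\<phi> (M.M.right_contr \<epsilon>M x) = 0"
      by (simp add: M.M.functional_left_contr[OF M.M.functional_counit] M.M.functional_right_contr[OF \<phi>])
    then show "\<phi> x = \<phi> 0"
      using functional_zero[OF \<phi>] by (simp add: M.M.right_contr_counit)
  qed
  then show ?thesis
    using assms pair.linear_0[OF linear_coactions] by (auto simp: core_def)
qed

text \<open>For \<open>a > 0\<close> this is \<open>P\<^sub>t(E)\<close> with
  \<open>t = b / a\<close>, cleared of denominators; \<open>m\<close> is \<open>a\<close> times the
  maximal value.\<close>

definition optimal :: "nat \<Rightarrow> nat \<Rightarrow> 'm set \<Rightarrow> 'q set \<Rightarrow> nat \<Rightarrow> bool"
  where "optimal a b E P m \<longleftrightarrow>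
    fin_dim_subspace scaleQ P \<and> (\<forall>l\<in>contractions. l ` P \<subseteq> P) \<and>
    a * M.M.dim (core coactions E P) = b * Q.M.dim P + m \<and>
    (\<forall>U. fin_dim_subspace scaleQ U \<longrightarrow> (\<forall>l\<in>contractions. l ` U \<subseteq> U) \<longrightarrow>
      a * M.M.dim (core coactions E U) \<le> b * Q.M.dim U + m)"

lemma optimalD:
  assumes "optimal a b E P m"
  shows "fin_dim_subspace scaleQ P" "\<forall>l\<in>contractions. l ` P \<subseteq> P"
    "a * M.M.dim (core coactions E P) = b * Q.M.dim P + m"
    "\<And>U. fin_dim_subspace scaleQ U \<Longrightarrow> \<forall>l\<in>contractions. l ` U \<subseteq> U \<Longrightarrow>
      a * M.M.dim (core coactions E U) \<le> b * Q.M.dim U + m"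
  using assms unfolding optimal_def by auto

lemma optimal_exists:
  assumes E: "fin_dim_subspace scaleM E"
  shows "\<exists>P m. optimal a b E P m"
proof -
  have "\<forall>l\<in>contractions. l 0 = 0"
  proof
    fix l assume "l \<in> contractions"
    from linear_contractions[OF this] show "l 0 = 0"
      by (intro additive_zero) (simp add: Vector_Spaces.linear_iff)
  qed
  then obtain P m where "fin_dim_subspace scaleQ P" "\<forall>l\<in>contractions. l ` P \<subseteq> P"
    "a * M.M.dim (core coactions E P) = b * Q.M.dim P + m"
    "\<And>U. fin_dim_subspace scaleQ U \<Longrightarrow> \<forall>l\<in>contractions. l ` U \<subseteq> U \<Longrightarrow>
      a * M.M.dim (core coactions E U) \<le> b * Q.M.dim U + m"
    by (rule core_maximizer[OF pair.vector_space_pair_axioms E, of contractions a coactions b]) blast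
  then show ?thesis unfolding optimal_def by blast
qed

text \<open>
  With \<open>J\<close> the index set of the matrix \<open>c\<close> and \<open>\<gamma>\<close> its action, compare the sum
  \<open>R\<^sup>J + \<gamma> P\<^sup>J\<close> with \<open>R\<^sup>J\<close> and \<open>{z \<in> P\<^sup>J. \<gamma> z \<in> R\<^sup>J}\<close> with \<open>P\<^sup>J\<close>: both are stable under the
  contractions, so optimality bounds the dimensions of their cores, and \<open>b' < b\<close> forces
  \<open>\<gamma> P\<^sup>J \<subseteq> R\<^sup>J\<close>.
\<close>

lemma optimal_monotone:
  assumes c: "H.coefficient_matrix bs c"
    and E: "fin_dim_subspace scaleM E" and E': "fin_dim_subspace scaleM E'"
    and EE': "\<And>j k e. j \<in> set bs \<Longrightarrow> k \<in> set bs \<Longrightarrow> e \<in> E \<Longrightarrow> actM (c j k) e \<in> E'"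
    and optP: "optimal a b E P m" and optR: "optimal a b' E' R m'"
    and less: "b' < b"
    and jk: "j \<in> set bs" "k \<in> set bs" and p: "p \<in> P"
  shows "actQ (c j k) p \<in> R"
proof -
  note P = optimalD(1,2)[OF optP] and maxP = optimalD(3,4)[OF optP]
  note R = optimalD(1,2)[OF optR] and maxR = optimalD(3,4)[OF optR]
  let ?J = "set bs"
  let ?n = "card ?J"
  let ?\<gamma>M = "matrix_action actM ?J c" and ?\<gamma>Q = "matrix_action actQ ?J c"
  let ?PJ = "power_space ?J P" and ?RJ = "power_space ?J R"
  let ?EP = "core coactions E P" and ?ER = "core coactions E' R"
  let ?EPJ = "power_space ?J ?EP" and ?ERJ = "power_space ?J ?ER"
  let ?T = "(\<circ>) ` coactions"
  let ?U = "{z\<in>?PJ. ?\<gamma>Q z \<in> ?RJ}" and ?S = "subspace_sum ?RJ (?\<gamma>Q ` ?PJ)"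
  \<comment> \<open>\<open>?X\<close> and \<open>?Y\<close> are the counterparts of
    \<open>?U\<close> and \<open>?S\<close> over \<open>M\<close>. They lie in the cores of
    \<open>?U\<close> and \<open>?S\<close>, so that their dimensions are lower bounds for those of
    the cores.\<close>
  let ?X = "{z\<in>?EPJ. ?\<gamma>M z \<in> ?ERJ}" and ?Y = "subspace_sum ?ERJ (?\<gamma>M ` ?EPJ)"
  interpret pM: vector_space "power_scale scaleM" by (rule vector_space_power_scale) unfold_locales
  interpret pQ: vector_space "power_scale scaleQ" by (rule vector_space_power_scale) unfold_locales
  interpret pMM: vector_space_pair "power_scale scaleM" "power_scale scaleM" ..
  interpret pQQ: vector_space_pair "power_scale scaleQ" "power_scale scaleQ" ..
  interpret pMQ: vector_space_pair "power_scale scaleM" "power_scale scaleQ" ..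
  note vM = M.M.vector_space_axioms and vQ = Q.M.vector_space_axioms
  note subP = Q.M.fin_dim_subspaceD[OF P(1)] and subR = Q.M.fin_dim_subspaceD[OF R(1)]
  have fin: "finite ?J" by simp
  have EP: "fin_dim_subspace scaleM ?EP" and ER: "fin_dim_subspace scaleM ?ER"
    using pair.fin_dim_core[OF E subP linear_coactions] pair.fin_dim_core[OF E' subR linear_coactions]
    by auto
  note fdP = fin_dim_dim_power_space[OF vQ P(1) fin] and fdR = fin_dim_dim_power_space[OF vQ R(1) fin]
  note fdEP = fin_dim_dim_power_space[OF vM EP fin] and fdER = fin_dim_dim_power_space[OF vM ER fin]
  note fdE = fin_dim_dim_power_space(1)[OF vM E fin] and fdE' = fin_dim_dim_power_space(1)[OF vM E' fin]
  note linM = M.linear_matrix_action[of ?J c] and linQ = Q.linear_matrix_action[of ?J c]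
  have T': "\<And>t. t \<in> ?T \<Longrightarrow> Vector_Spaces.linear (power_scale scaleM) (power_scale scaleQ) t"
    using linear_comp_power[OF linear_coactions] by blast
  note dimQ = pQQ.dim_sum_image[OF linQ fdP(1) fdR(1)]
  note dimM = pMM.dim_sum_image[OF linM fdEP(1) fdER(1)]
  have S: "fin_dim_subspace (power_scale scaleQ) ?S"
    by (rule pQ.fin_dim_subspace_sum[OF fdR(1) pQQ.fin_dim_image[OF linQ fdP(1)]])
  have "pQ.subspace ?U"
    using pQ.subspace_inter[OF pQ.fin_dim_subspaceD[OF fdP(1)]
        pQQ.linear_subspace_linear_preimage[OF linQ pQ.fin_dim_subspaceD[OF fdR(1)]]]
    by (simp add: Int_def)
  then have U: "fin_dim_subspace (power_scale scaleQ) ?U"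
    by (rule pQ.fin_dim_subset[OF fdP(1)]) auto

  have contraction_cases: thesis
    if "l \<in> contractions"
      and "\<And>\<phi>. functional scaleQ \<phi> \<Longrightarrow> l = Q.M.left_contr \<phi> \<Longrightarrow> thesis"
      and "\<And>\<phi>. functional scaleQ \<phi> \<Longrightarrow> l = Q.M.right_contr \<phi> \<Longrightarrow> thesis" for l thesis
    using that by (auto simp: contractions_def)
  have contr: "Q.M.left_contr \<phi> \<in> contractions" "Q.M.right_contr \<phi> \<in> contractions"
    if "functional scaleQ \<phi>" for \<phi>
    using that by (auto simp: contractions_def)
  have contr_P: "l x \<in> P" if "l \<in> contractions" "x \<in> P" for l x using P(2) that by blast
  have contr_R: "l x \<in> R" if "l \<in> contractions" "x \<in> R" for l x using R(2) that by blast
  have l0: "l 0 = 0" if "l \<in> contractions" for l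
    by (rule additive_zero) (use linear_contractions[OF that] in \<open>simp add: Vector_Spaces.linear_iff\<close>)
  have t0: "t 0 = 0" if "t \<in> coactions" for t
    by (rule additive_zero) (use linear_coactions[OF that] in \<open>simp add: Vector_Spaces.linear_iff\<close>)

  \<comment> \<open>The antipode enters here: the entries of the matrix action on
    \<open>l \<circ> z\<close> are sums of contractions of entries of \<open>?\<gamma>Q z\<close>,
    which lie in the stable subspace \<open>R\<close>.\<close>
  have U_inv: "\<forall>l\<in>contractions. \<forall>z\<in>?U. l \<circ> z \<in> ?U"
  proof (intro ballI)
    fix l z assume l: "l \<in> contractions" and z: "z \<in> ?U"
    have "?\<gamma>Q z k \<in> R" if "k \<in> ?J" for k using z that by (auto simp: power_space_def)
    then have in_R: "l' (?\<gamma>Q z k) \<in> R" if "l' \<in> contractions" "k \<in> ?J" for l' k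
      using contr_R that by blast
    have "?\<gamma>Q (l \<circ> z) \<in> ?RJ"
      using l
    proof (rule contraction_cases)
      fix \<phi> assume \<phi>: "functional scaleQ \<phi>" "l = Q.M.left_contr \<phi>"
      show ?thesis
        unfolding \<phi>(2) using contr(1) in_R by (intro L.matrix_action_contract_in[OF c \<phi>(1) subR]) auto
    next
      fix \<phi> assume \<phi>: "functional scaleQ \<phi>" "l = Q.M.right_contr \<phi>"
      show ?thesis
        unfolding \<phi>(2) using contr(2) in_R by (intro R.matrix_action_contract_in[OF c \<phi>(1) subR]) auto
    qed
    moreover have "l \<circ> z \<in> ?PJ"
      using z contr_P[OF l] l0[OF l] by (auto simp: power_space_def)
    ultimately show "l \<circ> z \<in> ?U" by simp
  qed
  \<comment> \<open>Both summands are stable, the second because contractions pass through the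
    matrix action.\<close>
  have S_inv: "\<forall>l\<in>contractions. \<forall>z\<in>?S. l \<circ> z \<in> ?S"
  proof (intro ballI)
    fix l z assume l: "l \<in> contractions" and "z \<in> ?S"
    then obtain x y where z: "z = x + ?\<gamma>Q y" "x \<in> ?RJ" "y \<in> ?PJ"
      by (auto simp: subspace_sum_def)
    have "l \<circ> x \<in> ?RJ"
      using z(2) contr_R[OF l] l0[OF l] by (auto simp: power_space_def)
    moreover have "l \<circ> ?\<gamma>Q y \<in> ?\<gamma>Q ` ?PJ"
      using l
    proof (rule contraction_cases)
      fix \<phi> assume \<phi>: "functional scaleQ \<phi>" "l = Q.M.left_contr \<phi>"
      show ?thesis
        unfolding \<phi>(2) using contr(1) contr_P
        by (intro L.contract_matrix_action_in[OF c \<phi>(1) subP _ z(3)]) auto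
    next
      fix \<phi> assume \<phi>: "functional scaleQ \<phi>" "l = Q.M.right_contr \<phi>"
      show ?thesis
        unfolding \<phi>(2) using contr(2) contr_P
        by (intro R.contract_matrix_action_in[OF c \<phi>(1) subP _ z(3)]) auto
    qed
    moreover have "l \<circ> z = (l \<circ> x) + (l \<circ> ?\<gamma>Q y)"
      using linear_contractions[OF l] by (auto simp: z(1) fun_eq_iff Vector_Spaces.linear_iff)
    ultimately show "l \<circ> z \<in> ?S" unfolding subspace_sum_def by blast
  qed
  have ER_E': "?ER \<subseteq> E'" and EP_E: "?EP \<subseteq> E" by (auto simp: core_def)
  have coaction_EP: "t x \<in> P" if "t \<in> coactions" "x \<in> ?EP" for t x using that by (simp add: core_def)
  have coaction_ER: "t x \<in> R" if "t \<in> coactions" "x \<in> ?ER" for t x using that by (simp add: core_def)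
  have coaction: "(\<lambda>m. q (M.M.left_contr \<phi> m)) \<in> coactions" if "functional scaleM \<phi>" for \<phi>
    using that by (auto simp: coactions_def)
  have Y_core: "?Y \<subseteq> core ?T (power_space ?J E') ?S"
  proof
    fix z assume "z \<in> ?Y"
    then obtain x y where z: "z = x + ?\<gamma>M y" "x \<in> ?ERJ" "y \<in> ?EPJ"
      by (auto simp: subspace_sum_def)
    have subE': "M.M.subspace E'" by (rule M.M.fin_dim_subspaceD[OF E'])
    have y: "y j \<in> E" if "j \<in> ?J" for j using z(3) that EP_E by (auto simp: power_space_def)
    have "x \<in> power_space ?J E'" using z(2) ER_E' by (auto simp: power_space_def)
    moreover have "?\<gamma>M y \<in> power_space ?J E'"
      using EE' y by (auto simp: power_space_def matrix_action_def intro!: M.M.subspace_sum[OF subE'])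
    ultimately have "z \<in> power_space ?J E'"
      unfolding z(1) by (rule pM.subspace_add[OF pM.fin_dim_subspaceD[OF fdE']])
    moreover have "t \<circ> z \<in> ?S" if t: "t \<in> coactions" for t
    proof -
      obtain \<phi> where \<phi>: "functional scaleM \<phi>" "t = (\<lambda>m. q (M.M.left_contr \<phi> m))"
        using t by (auto simp: coactions_def)
      have "t \<circ> x \<in> ?RJ"
        using z(2) coaction_ER[OF t] t0[OF t] by (auto simp: power_space_def)
      moreover have "t \<circ> ?\<gamma>M y \<in> ?\<gamma>Q ` ?PJ"
        unfolding \<phi>(2) using coaction_EP[OF coaction]
        by (intro T.contract_matrix_action_in[OF c \<phi>(1) subP _ z(3)])
      moreover have "t \<circ> z = (t \<circ> x) + (t \<circ> ?\<gamma>M y)"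
        using linear_coactions[OF t] by (auto simp: z(1) fun_eq_iff Vector_Spaces.linear_iff)
      ultimately show ?thesis unfolding subspace_sum_def by blast
    qed
    ultimately show "z \<in> core ?T (power_space ?J E') ?S" by (simp add: core_def)
  qed
  have X_core: "?X \<subseteq> core ?T (power_space ?J E) ?U"
  proof
    fix z assume z: "z \<in> ?X"
    have "z \<in> power_space ?J E" using z EP_E by (auto simp: power_space_def)
    moreover have "t \<circ> z \<in> ?U" if t: "t \<in> coactions" for t
    proof -
      obtain \<phi> where \<phi>: "functional scaleM \<phi>" "t = (\<lambda>m. q (M.M.left_contr \<phi> m))"
        using t by (auto simp: coactions_def)
      have "t \<circ> z \<in> ?PJ"
        using z coaction_EP[OF t] t0[OF t] by (auto simp: power_space_def)
      moreover have "?\<gamma>M z k \<in> ?ER" if "k \<in> ?J" for k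
        using z that by (auto simp: power_space_def)
      then have "?\<gamma>Q (t \<circ> z) \<in> ?RJ"
        unfolding \<phi>(2) using coaction_ER[OF coaction]
          by (intro T.matrix_action_contract_in[OF c \<phi>(1) subR]) blast
      ultimately show ?thesis by simp
    qed
    ultimately show "z \<in> core ?T (power_space ?J E) ?U" by (simp add: core_def)
  qed

  have S_UNIV: "?S \<subseteq> power_space ?J UNIV"
    by (auto simp: subspace_sum_def power_space_def matrix_action_def)
  have U_UNIV: "?U \<subseteq> power_space ?J UNIV"
    by (auto simp: power_space_def)
  have "pM.dim ?X \<le> pM.dim (core ?T (power_space ?J E) ?U)"
    by (rule pM.dim_subset_fin_dim[OF pMQ.fin_dim_core[OF fdE pQ.fin_dim_subspaceD[OF U] T'] X_core])
  then have 1: "a * pM.dim ?X \<le> b * pQ.dim ?U + ?n * m"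
    using pair.dim_core_power_bound[OF E linear_coactions linear_contractions maxP(2) fin U U_UNIV U_inv]
    by (meson mult_le_mono2 order_trans)
  have "pM.dim ?Y \<le> pM.dim (core ?T (power_space ?J E') ?S)"
    by (rule pM.dim_subset_fin_dim[OF pMQ.fin_dim_core[OF fdE' pQ.fin_dim_subspaceD[OF S] T'] Y_core])
  then have 2: "a * pM.dim ?Y \<le> b' * pQ.dim ?S + ?n * m'"
    using pair.dim_core_power_bound[OF E' linear_coactions linear_contractions maxR(2) fin S S_UNIV S_inv]
    by (meson mult_le_mono2 order_trans)
  \<comment> \<open>Over \<open>Q\<close> and over \<open>M\<close> the dimensions of preimage and
    sum add up to those of the two powers, and \<open>b' < b\<close> rules out a preimage smaller
    than \<open>?PJ\<close>.\<close>
  have "?n * Q.M.dim P \<le> pQ.dim ?U"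
    using optimal_dim_arith[OF 1 2 dimQ dimM maxP(1) maxR(1) less fdP(2) fdR(2) fdEP(2) fdER(2)] .
  then have "?U = ?PJ"
    using fdP by (intro pQ.subspace_eq_fin_dim[OF fdP(1) pQ.fin_dim_subspaceD[OF U]]) auto
  \<comment> \<open>The family supported at \<open>j\<close> with value \<open>p\<close> has
    \<open>actQ (c j k) p\<close> as coordinate \<open>k\<close> of its image.\<close>
  moreover have "(\<lambda>i. if i = j then p else 0) \<in> ?PJ"
    using jk p Q.M.subspace_0[OF subP] by (auto simp: power_space_def)
  ultimately have "?\<gamma>Q (\<lambda>i. if i = j then p else 0) k \<in> R"
    using jk(2) by (auto simp: power_space_def)
  moreover have "actQ h 0 = 0" for h using Q.act_add_right[of h 0 0] by simp
  then have "?\<gamma>Q (\<lambda>i. if i = j then p else 0) k = (\<Sum>i\<in>?J. if i = j then actQ (c i k) p else 0)"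
    unfolding matrix_action_def if_P[OF jk(2)] by (intro sum.cong) auto
  ultimately show ?thesis using jk(1) by simp
qed

end

section \<open>The layer-cake argument\<close>

text \<open>A discrete integral of slopes: on each unit interval \<open>p\<close> at the left end
  bounds the decrease of \<open>x\<close> from above, and \<open>r\<close> at the right end bounds
  that of \<open>y\<close> from below. Together with the unit shift between \<open>p\<close> and
  \<open>r\<close> this costs two steps, whence \<open>x 2\<close> against
  \<open>y 0\<close>.\<close>

lemma layer_cake_bound:
  fixes p r x y :: "nat \<Rightarrow> nat" and K :: real
  assumes K: "K \<ge> 0"
    and x: "\<And>v. x v \<le> x (Suc v) + p v" and y: "\<And>v. y (Suc v) + r (Suc v) \<le> y v"
    and pr: "\<And>v. K * p (Suc (Suc v)) \<le> r (Suc v)" and x0: "x (2 + n) = 0"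
  shows "K * x 2 \<le> y 0"
proof -
  have 1: "x 2 \<le> x (2 + n) + (\<Sum>v<n. p (Suc (Suc v)))" for n
  proof (induction n)
    case (Suc n)
    then show ?case using x[of "2 + n"] by simp
  qed simp
  have 2: "y n + (\<Sum>v<n. r (Suc v)) \<le> y 0" for n
  proof (induction n)
    case (Suc n)
    then show ?case using y[of n] by simp
  qed simp
  have "K * x 2 \<le> K * (\<Sum>v<n. p (Suc (Suc v)))"
    using 1[of n] x0 K by (intro mult_left_mono) (simp_all flip: of_nat_sum)
  also have "\<dots> = (\<Sum>v<n. K * p (Suc (Suc v)))"
    by (simp add: sum_distrib_left)
  also have "\<dots> \<le> (\<Sum>v<n. real (r (Suc v)))"
    using pr by (intro sum_mono)
  also have "\<dots> \<le> y 0"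
    using 2[of n] by (simp flip: of_nat_sum)
  finally show ?thesis .
qed

context module_coalgebra
begin

lemma fin_dim_action_span:
  assumes F: "fin_dim_subspace scaleH F" and E: "fin_dim_subspace scaleM E"
  shows "fin_dim_subspace scaleM (action_span scaleM act F E)"
proof -
  obtain X Y where X: "finite X" "H.span X = F" and Y: "finite Y" "M.span Y = E"
    using F E by (auto simp: fin_dim_subspace_def)
  let ?G = "(\<lambda>(x, y). act x y) ` (X \<times> Y)"
  have 1: "act x e \<in> M.span ?G" if x: "x \<in> X" and e: "e \<in> M.span Y" for x e
    using e
  proof (induction rule: M.span_induct_alt)
    case base
    have "act x 0 = 0" using act_add_right[of x 0 0] by simp
    then show ?case by (simp add: M.span_zero)
  next
    case (step c y z)
    have "act x y \<in> M.span ?G" using x step by (intro M.span_base) auto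
    then show ?case using step by (simp add: act_add_right act_scale_right M.span_add M.span_scale)
  qed
  have 2: "act h e \<in> M.span ?G" if h: "h \<in> H.span X" and e: "e \<in> E" for h e
    using h
  proof (induction rule: H.span_induct_alt)
    case base
    have "act 0 e = 0" using act_add_left[of 0 0 e] by simp
    then show ?case by (simp add: M.span_zero)
  next
    case (step c x h)
    have "act x e \<in> M.span ?G" using 1 step e Y by blast
    then show ?case using step by (simp add: act_add_left act_scale_left M.span_add M.span_scale)
  qed
  have "action_span scaleM act F E \<subseteq> M.span ?G"
    unfolding action_span_def using 2 X by (intro M.span_minimal) auto
  then show ?thesis
    using X Y by (intro M.fin_dim_subspaceI[of _ ?G]) (auto simp: action_span_def)
qed

lemma action_span_subset:
  assumes F: "F \<subseteq> H.span C" and R: "M.subspace R" and "\<And>c e. c \<in> C \<Longrightarrow> e \<in> E \<Longrightarrow> act c e \<in> R"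
  shows "action_span scaleM act F E \<subseteq> R"
proof -
  have "act h e \<in> R" if h: "h \<in> H.span C" and e: "e \<in> E" for h e
    using h
  proof (induction rule: H.span_induct_alt)
    case base
    have "act 0 e = 0" using act_add_left[of 0 0 e] by simp
    then show ?case by (simp add: M.subspace_0[OF R])
  next
    case (step c x h)
    then show ?case
      using assms(3) e R by (simp add: act_add_left act_scale_left M.subspace_add M.subspace_scale)
  qed
  then show ?thesis
    unfolding action_span_def using F by (intro M.span_minimal[OF _ R]) auto
qed

end

section \<open>Transfer of amenability from \<open>M\<close> to \<open>Q\<close>\<close>

context module_coalgebra_morphism
begin

text \<open>If \<open>Q\<close> fails for \<open>F\<close> and \<open>e\<close>, every
  finite-dimensional subcoalgebra of \<open>Q\<close> grows by a factor of at least
  \<open>1 + e\<close>. Amenability of \<open>M\<close> supplies \<open>E\<close> growing by less,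
  which the layer-cake bound with step \<open>1 / N\<close> contradicts for large
  \<open>N\<close>.\<close>

lemma amenable_image:
  assumes M: "amenable scaleH scaleM \<Delta>M actM"
  shows "amenable scaleH scaleQ \<Delta>Q actQ"
  unfolding amenable_def
proof (intro allI impI, rule ccontr)
  fix F and e :: real
  assume F: "fin_dim_subspace scaleH F" and e: "e > 0"
    and "\<nexists>D. fin_dim_subspace scaleQ D \<and> subcoalgebra scaleQ \<Delta>Q D \<and>
      real (quotient_dim scaleQ (subspace_sum D (action_span scaleQ actQ F D)) D) < e * real (Q.M.dim D)"
  then have non_amenable: "e * real (Q.M.dim D) \<le>
      real (quotient_dim scaleQ (subspace_sum D (action_span scaleQ actQ F D)) D)"
    if "fin_dim_subspace scaleQ D" "subcoalgebra scaleQ \<Delta>Q D" for D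
    using that by (meson not_less)
  obtain X where X: "finite X" "H.span X = F" using F by (auto simp: fin_dim_subspace_def)
  \<comment> \<open>The unit is included so that a subspace receiving the coefficients times
    \<open>P\<close> contains \<open>P\<close> itself besides \<open>F P\<close>.\<close>
  obtain bs c where c: "H.coefficient_matrix bs c"
    and sup: "insert 1 X \<subseteq> H.span {c j k |j k. j \<in> set bs \<and> k \<in> set bs}"
    by (rule H.coefficient_matrix_exists[of "insert 1 X"]) (use X in auto)
  let ?C = "{c j k |j k. j \<in> set bs \<and> k \<in> set bs}"
  have "?C = (\<lambda>(j, k). c j k) ` (set bs \<times> set bs)" by auto
  then have F': "fin_dim_subspace scaleH (H.span ?C)"
    by (intro H.fin_dim_span) (simp del: image_Collect)
  have FC: "F \<subseteq> H.span ?C" using sup X(2) H.span_minimal[of X "H.span ?C"] by auto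
  \<comment> \<open>Amenability is applied to the span of the coefficients, since
    \<open>optimal_monotone\<close> needs all of them to map \<open>E\<close> into
    \<open>?E'\<close>.\<close>
  obtain E where E: "fin_dim_subspace scaleM E" "subcoalgebra scaleM \<Delta>M E"
    and less: "real (quotient_dim scaleM (subspace_sum E (action_span scaleM actM (H.span ?C) E)) E)
      < e * real (M.M.dim E)"
    using M F' e unfolding amenable_def by blast
  let ?E' = "subspace_sum E (action_span scaleM actM (H.span ?C) E)"
  have subE: "M.M.subspace E" using E(1) by (rule M.M.fin_dim_subspaceD)
  have act_span: "fin_dim_subspace scaleM (action_span scaleM actM (H.span ?C) E)"
    by (rule M.fin_dim_action_span[OF F' E(1)])
  have E': "fin_dim_subspace scaleM ?E'"
    by (rule M.M.fin_dim_subspace_sum[OF E(1) act_span])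
  note sup_E' = M.M.subspace_sum_superset[OF subE M.M.fin_dim_subspaceD[OF act_span]]
  have dimE': "real (M.M.dim ?E') < (1 + e) * real (M.M.dim E)"
    using less M.M.quotient_dim_eq[OF E' subE sup_E'(1)]
    by (simp add: distrib_right flip: of_nat_add)
  have EE': "actM (c j k) x \<in> ?E'" if "j \<in> set bs" "k \<in> set bs" "x \<in> E" for j k x
  proof -
    have "actM (c j k) x \<in> action_span scaleM actM (H.span ?C) E"
      unfolding action_span_def using that H.span_base[of "c j k" ?C] by (intro M.M.span_base) blast
    then show ?thesis using sup_E'(2) by blast
  qed
  have expand: "(1 + e) * real (Q.M.dim P) \<le> real (Q.M.dim R)"
    if P: "fin_dim_subspace scaleQ P" "\<forall>l\<in>contractions. l ` P \<subseteq> P" and R: "fin_dim_subspace scaleQ R"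
      and PR: "\<And>j k x. j \<in> set bs \<Longrightarrow> k \<in> set bs \<Longrightarrow> x \<in> P \<Longrightarrow> actQ (c j k) x \<in> R" for P R
  proof -
    let ?W = "subspace_sum P (action_span scaleQ actQ F P)"
    have subP: "Q.M.subspace P" and subR: "Q.M.subspace R"
      using P(1) R by (auto intro: Q.M.fin_dim_subspaceD)
    have "actQ x y \<in> R" if "x \<in> ?C" "y \<in> P" for x y using that PR by blast
    note span_R = Q.action_span_subset[OF _ subR this]
    have "y \<in> action_span scaleQ actQ {1} P" if "y \<in> P" for y
      unfolding action_span_def using that Q.act_one[of y] by (intro Q.M.span_base) force
    then have "P \<subseteq> R" using span_R[of "{1}"] sup by blast
    then have "?W \<subseteq> R" using span_R[OF FC] subR by (intro Q.M.subspace_sum_minimal)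
    then have "Q.M.dim ?W \<le> Q.M.dim R" by (rule Q.M.dim_subset_fin_dim[OF R])
    moreover have act_span: "fin_dim_subspace scaleQ (action_span scaleQ actQ F P)"
      by (rule Q.fin_dim_action_span[OF F P(1)])
    have "quotient_dim scaleQ ?W P + Q.M.dim P = Q.M.dim ?W"
      by (rule Q.M.quotient_dim_eq[OF Q.M.fin_dim_subspace_sum[OF P(1) act_span] subP
            Q.M.subspace_sum_superset(1)[OF subP Q.M.fin_dim_subspaceD[OF act_span]]])
    ultimately show ?thesis
      using non_amenable[OF P(1) subcoalgebra_contractions[OF P]]
      by (simp add: distrib_right)
  qed
  let ?d = "Q.M.dim (q ` E)"
  have core_le: "M.M.dim (core coactions E P) \<le> M.M.dim E"
    if "fin_dim_subspace scaleM E" for E P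
    by (rule M.M.dim_subset_fin_dim[OF that]) (auto simp: core_def)
  \<comment> \<open>The term \<open>2 * ?d\<close> is the loss of two layers; it does not depend on
    \<open>N\<close>, while the other terms grow with \<open>N\<close>.\<close>
  have bound: "(1 + e) * (real N * real (M.M.dim E) - 2 * real ?d) \<le> real N * real (M.M.dim ?E')" for N
  proof -
    have "\<forall>v. \<exists>P m. optimal N v E P m" "\<forall>v. \<exists>R m. optimal N v ?E' R m"
      using optimal_exists[OF E(1)] optimal_exists[OF E'] by blast+
    then obtain P x R y where P: "\<And>v. optimal N v E (P v) (x v)" and R: "\<And>v. optimal N v ?E' (R v) (y v)"
      unfolding choice_iff by blast
    let ?p = "\<lambda>v. Q.M.dim (P v)" and ?r = "\<lambda>v. Q.M.dim (R v)"
    have "(1 + e) * x 2 \<le> y 0"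
    proof (rule layer_cake_bound)
      show "x v \<le> x (Suc v) + ?p v" for v
      proof -
        have "N * M.M.dim (core coactions E (P v)) \<le> Suc v * ?p v + x (Suc v)"
          by (rule optimalD(4)[OF P optimalD(1,2)[OF P]])
        then show ?thesis using optimalD(3)[OF P, of v] by simp
      qed
      show "y (Suc v) + ?r (Suc v) \<le> y v" for v
      proof -
        have "N * M.M.dim (core coactions ?E' (R (Suc v))) \<le> v * ?r (Suc v) + y v"
          by (rule optimalD(4)[OF R optimalD(1,2)[OF R]])
        then show ?thesis using optimalD(3)[OF R, of "Suc v"] by simp
      qed
      \<comment> \<open>\<open>optimal_monotone\<close> compares strictly different parameters, here
        \<open>Suc v < Suc (Suc v)\<close>.\<close>
      show "(1 + e) * ?p (Suc (Suc v)) \<le> ?r (Suc v)" for v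
      proof (rule expand)
        fix j k z assume "j \<in> set bs" "k \<in> set bs" "z \<in> P (Suc (Suc v))"
        then show "actQ (c j k) z \<in> R (Suc v)"
          by (intro optimal_monotone[OF c E(1) E' EE' P R]) auto
      qed (use optimalD(1,2)[OF P] optimalD(1)[OF R] in auto)
      \<comment> \<open>Beyond \<open>N * dim E\<close> a nonzero subspace costs more than its core
        can gain, so the optimum is \<open>{0}\<close>, with zero core and value 0.\<close>
      show "x (2 + N * M.M.dim E) = 0"
      proof -
        let ?v = "2 + N * M.M.dim E"
        have eq: "N * M.M.dim (core coactions E (P ?v)) = ?v * ?p ?v + x ?v"
          by (rule optimalD(3)[OF P])
        show ?thesis
        proof (cases "?p ?v = 0")
          case True
          then have "P ?v = {0}" using Q.M.dim_eq_0_fin_dim optimalD(1)[OF P] by blast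
          then show ?thesis
            using eq core_zero[OF M.M.subspace_0[OF subE]] M.M.dim_zero_subspace by simp
        next
          case False
          have "?v * 1 \<le> ?v * ?p ?v" using False by (intro mult_le_mono2) simp
          then have "?v \<le> ?v * ?p ?v" by (simp only: mult_1_right)
          moreover have "N * M.M.dim (core coactions E (P ?v)) \<le> N * M.M.dim E"
            by (intro mult_le_mono2 core_le E(1))
          ultimately have "?v + x ?v \<le> N * M.M.dim E" unfolding eq by (metis add_le_mono1 order_trans)
          then show ?thesis by simp
        qed
      qed
    qed (use e in simp)
    \<comment> \<open>The image of \<open>E\<close> under \<open>q\<close> competes at parameter 2,
      and its core is all of \<open>E\<close>.\<close>
    moreover have "N * M.M.dim E \<le> 2 * ?d + x 2"
    proof -
      have "N * M.M.dim (core coactions E (q ` E)) \<le> 2 * ?d + x 2"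
        by (rule optimalD(4)[OF P pair.fin_dim_image[OF linear_q E(1)] contractions_image[OF E(2)]])
      then show ?thesis by (simp add: core_image[OF E(2)])
    qed
    then have "real N * real (M.M.dim E) - 2 * real ?d \<le> real (x 2)"
      by (simp flip: of_nat_mult)
    then have "(1 + e) * (real N * real (M.M.dim E) - 2 * real ?d) \<le> (1 + e) * real (x 2)"
      using e by (intro mult_left_mono) auto
    \<comment> \<open>At parameter 0 nothing is subtracted, and the value is \<open>N\<close> times
      the dimension of a core in \<open>?E'\<close>.\<close>
    moreover have "y 0 \<le> N * M.M.dim ?E'"
      using optimalD(3)[OF R, of 0] mult_le_mono2[OF core_le[OF E'], of N "R 0"] by simp
    then have "real (y 0) \<le> real N * real (M.M.dim ?E')" by (simp flip: of_nat_mult)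
    ultimately show ?thesis by linarith
  qed
  let ?\<delta> = "(1 + e) * real (M.M.dim E) - real (M.M.dim ?E')"
  have "?\<delta> > 0" using dimE' by simp
  \<comment> \<open>\<open>N\<close> is chosen so that the gain \<open>N * ?\<delta>\<close> exceeds
    the fixed loss.\<close>
  then obtain N where "real N * ?\<delta> > (1 + e) * (2 * real ?d)"
    using reals_Archimedean3 by blast
  then show False using bound[of N] by (simp add: algebra_simps)
qed

end

theorem theorem2:
  fixes scaleH :: "'k::field \<Rightarrow> 'h::ring_1 \<Rightarrow> 'h"
    and \<Delta>H :: "'h \<Rightarrow> ('h \<times> 'h) list"
    and \<epsilon>H :: "'h \<Rightarrow> 'k"
    and S :: "'h \<Rightarrow> 'h"
    and scaleM :: "'k \<Rightarrow> 'm::ab_group_add \<Rightarrow> 'm"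
    and \<Delta>M :: "'m \<Rightarrow> ('m \<times> 'm) list"
    and \<epsilon>M :: "'m \<Rightarrow> 'k"
    and actM :: "'h \<Rightarrow> 'm \<Rightarrow> 'm"
    and scaleQ :: "'k \<Rightarrow> 'q::ab_group_add \<Rightarrow> 'q"
    and \<Delta>Q :: "'q \<Rightarrow> ('q \<times> 'q) list"
    and \<epsilon>Q :: "'q \<Rightarrow> 'k"
    and actQ :: "'h \<Rightarrow> 'q \<Rightarrow> 'q"
    and q :: "'m \<Rightarrow> 'q"
  assumes "hopf_algebra scaleH \<Delta>H \<epsilon>H S"
    and "cocommutative scaleH \<Delta>H"
    and "module_coalgebra scaleH \<Delta>H \<epsilon>H scaleM \<Delta>M \<epsilon>M actM"
    and "module_coalgebra scaleH \<Delta>H \<epsilon>H scaleQ \<Delta>Q \<epsilon>Q actQ"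
    and "coalgebra_morphism scaleM \<Delta>M \<epsilon>M scaleQ \<Delta>Q \<epsilon>Q q"
    and "\<forall>h m. q (actM h m) = actQ h (q m)"
    and "surj q"
    and "amenable scaleH scaleM \<Delta>M actM"
  shows "amenable scaleH scaleQ \<Delta>Q actQ"
proof -
  interpret H: hopf_algebra scaleH \<Delta>H \<epsilon>H S by fact
  interpret M: module_coalgebra scaleH \<Delta>H \<epsilon>H scaleM \<Delta>M \<epsilon>M actM by fact
  interpret Q: module_coalgebra scaleH \<Delta>H \<epsilon>H scaleQ \<Delta>Q \<epsilon>Q actQ by fact
  interpret module_coalgebra_morphism scaleH \<Delta>H \<epsilon>H S scaleM \<Delta>M \<epsilon>M actM scaleQ \<Delta>Q \<epsilon>Q actQ q
    by unfold_locales (use assms in auto)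
  show ?thesis using assms(8) by (rule amenable_image)
qed

end
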